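(* Let $n\ge 2$ and $m\ge 2$ be integers, and let $X\subset\mathbb{C}\mathbb{P}^{n^m-1}$ be the set of classes $[A]$ of nonzero $n$-dimensional $m$th order complex hypermatrices $A$, up to scalar multiplication, such that $A$ is irregular. Then the Zariski closure $\bar X$ of $X$ has codimension at least $2$ in $\mathbb{C}\mathbb{P}^{n^m-1}$.
   Context: For a hypermatrix $A=(a_{i_1\cdots i_m})$ with complex entries, $1\le i_1,\dots,i_m\le n$, and $x\in\mathbb{C}^n$, $Ax^{m-1}$ is the vector with components $(Ax^{m-1})_i=\sum_{i_2,\dots,i_m=1}^n a_{ii_2\cdots i_m}x_{i_2}\cdots x_{i_m}$. $A$ is called irregular if there exists $x\in\mathbb{C}^n\setminus\{0\}$ such that $Ax^{m-1}=0$ and $x^Tx=\sum_i x_i^2=0$; otherwise $A$ is regular. *)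

theory Defs
  imports
    "HOL-Analysis.Abstract_Topology"
    "HOL-Library.Poly_Mapping"
    "HOL-Library.Extended_Nat"
    Complex_Main
begin

definition irreducible_closedin :: "'a topology \<Rightarrow> 'a set \<Rightarrow> bool" where
  "irreducible_closedin T Z \<longleftrightarrow>
     closedin T Z \<and> Z \<noteq> {} \<and>
     (\<forall>A B. closedin T A \<and> closedin T B \<and> Z = A \<union> B \<longrightarrow> Z = A \<or> Z = B)"

text \<open>The codimension of an irreducible closed set \<open>Z\<close> is the supremum of the lengths \<open>k\<close> of chains
  \<open>Z = C 0 \<subset> C 1 \<subset> \<dots> \<subset> C k\<close> of irreducible closed sets; the codimension of an arbitrary closed
  set is the infimum over its irreducible closed subsets (so it is \<open>\<infinity>\<close> for the empty set).\<close>

definition codim_irreducible :: "'a topology \<Rightarrow> 'a set \<Rightarrow> enat" where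
  "codim_irreducible T Z =
     Sup {enat k | k. \<exists>C :: nat \<Rightarrow> 'a set.
            C 0 = Z \<and> (\<forall>i\<le>k. irreducible_closedin T (C i)) \<and> (\<forall>i<k. C i \<subset> C (Suc i))}"

definition codimension :: "'a topology \<Rightarrow> 'a set \<Rightarrow> enat" where
  "codimension T Y = (INF Z \<in> {Z. irreducible_closedin T Z \<and> Z \<subseteq> Y}. codim_irreducible T Z)"

text \<open>A monomial is a finitely supported exponent function \<open>'i \<Rightarrow>\<^sub>0 nat\<close>; a polynomial is a
  finitely supported coefficient function on monomials.\<close>

type_synonym 'i cpoly = "('i \<Rightarrow>\<^sub>0 nat) \<Rightarrow>\<^sub>0 complex"

definition monom_eval :: "('i \<Rightarrow>\<^sub>0 nat) \<Rightarrow> ('i \<Rightarrow> complex) \<Rightarrow> complex" where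
  "monom_eval t a = (\<Prod>i\<in>Poly_Mapping.keys t. a i ^ Poly_Mapping.lookup t i)"

definition monom_degree :: "('i \<Rightarrow>\<^sub>0 nat) \<Rightarrow> nat" where
  "monom_degree t = (\<Sum>i\<in>Poly_Mapping.keys t. Poly_Mapping.lookup t i)"

definition cpoly_eval :: "'i cpoly \<Rightarrow> ('i \<Rightarrow> complex) \<Rightarrow> complex" where
  "cpoly_eval p a = (\<Sum>t\<in>Poly_Mapping.keys p. Poly_Mapping.lookup p t * monom_eval t a)"

definition cpoly_vars :: "'i cpoly \<Rightarrow> 'i set" where
  "cpoly_vars p = (\<Union>t\<in>Poly_Mapping.keys p. Poly_Mapping.keys t)"

definition homogeneous_cpoly :: "'i cpoly \<Rightarrow> bool" where
  "homogeneous_cpoly p \<longleftrightarrow> (\<exists>d. \<forall>t\<in>Poly_Mapping.keys p. monom_degree t = d)"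

text \<open>Vectors in \<open>\<complex>\<^sup>I\<close> are represented by functions vanishing outside \<open>I\<close>.\<close>

definition coord_space :: "'i set \<Rightarrow> ('i \<Rightarrow> complex) set" where
  "coord_space I = {a. \<forall>i. i \<notin> I \<longrightarrow> a i = 0}"

definition proj_rel :: "'i set \<Rightarrow> (('i \<Rightarrow> complex) \<times> ('i \<Rightarrow> complex)) set" where
  "proj_rel I = {(a, b). a \<in> coord_space I - {\<lambda>_. 0} \<and> b \<in> coord_space I - {\<lambda>_. 0} \<and>
                         (\<exists>c. c \<noteq> 0 \<and> b = (\<lambda>i. c * a i))}"

definition proj_space :: "'i set \<Rightarrow> ('i \<Rightarrow> complex) set set" where
  "proj_space I = (coord_space I - {\<lambda>_. 0}) // proj_rel I"

definition proj_class :: "'i set \<Rightarrow> ('i \<Rightarrow> complex) \<Rightarrow> ('i \<Rightarrow> complex) set" where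
  "proj_class I a = proj_rel I `` {a}"

definition proj_zero_locus :: "'i set \<Rightarrow> 'i cpoly set \<Rightarrow> ('i \<Rightarrow> complex) set set" where
  "proj_zero_locus I S = {P \<in> proj_space I. \<forall>p\<in>S. \<forall>a\<in>P. cpoly_eval p a = 0}"

definition proj_algebraic :: "'i set \<Rightarrow> ('i \<Rightarrow> complex) set set \<Rightarrow> bool" where
  "proj_algebraic I Z \<longleftrightarrow>
     (\<exists>S. (\<forall>p\<in>S. homogeneous_cpoly p \<and> cpoly_vars p \<subseteq> I) \<and> Z = proj_zero_locus I S)"

definition zariski_topology :: "'i set \<Rightarrow> ('i \<Rightarrow> complex) set topology" where
  "zariski_topology I = topology (\<lambda>U. U \<subseteq> proj_space I \<and> proj_algebraic I (proj_space I - U))"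

lemma equiv_proj_rel: "equiv (coord_space I - {\<lambda>_. 0}) (proj_rel I)"
proof (rule equivI)
  show "proj_rel I \<subseteq> (coord_space I - {\<lambda>_. 0}) \<times> (coord_space I - {\<lambda>_. 0})"
    by (auto simp: proj_rel_def)
  show "refl_on (coord_space I - {\<lambda>_. 0}) (proj_rel I)"
    by (auto simp: refl_on_def proj_rel_def intro: exI[of _ 1])
  show "sym (proj_rel I)"
  proof (rule symI)
    fix a b assume "(a, b) \<in> proj_rel I"
    then obtain c where c: "c \<noteq> 0" "b = (\<lambda>i. c * a i)"
      "a \<in> coord_space I - {\<lambda>_. 0}" "b \<in> coord_space I - {\<lambda>_. 0}"
      by (auto simp: proj_rel_def)
    then have "a = (\<lambda>i. inverse c * b i)" "inverse c \<noteq> 0" by (auto simp: field_simps)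
    with c(3,4) show "(b, a) \<in> proj_rel I" unfolding proj_rel_def by blast
  qed
  show "trans (proj_rel I)"
  proof (rule transI)
    fix a b d assume "(a, b) \<in> proj_rel I" "(b, d) \<in> proj_rel I"
    then obtain c c' where c: "c \<noteq> 0" "b = (\<lambda>i. c * a i)" "c' \<noteq> 0" "d = (\<lambda>i. c' * b i)"
      "a \<in> coord_space I - {\<lambda>_. 0}" "d \<in> coord_space I - {\<lambda>_. 0}"
      by (auto simp: proj_rel_def)
    then have "d = (\<lambda>i. (c' * c) * a i)" "c' * c \<noteq> 0" by (auto simp: mult.assoc)
    with c(5,6) show "(a, d) \<in> proj_rel I" unfolding proj_rel_def by blast
  qed
qed

lemma monom_eval_superset:
  assumes "finite K" "Poly_Mapping.keys t \<subseteq> K"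
  shows "monom_eval t a = (\<Prod>i\<in>K. a i ^ Poly_Mapping.lookup t i)"
  unfolding monom_eval_def using assms
  by (intro prod.mono_neutral_left) (auto simp: in_keys_iff)

lemma monom_degree_superset:
  assumes "finite K" "Poly_Mapping.keys t \<subseteq> K"
  shows "monom_degree t = (\<Sum>i\<in>K. Poly_Mapping.lookup t i)"
  unfolding monom_degree_def using assms
  by (intro sum.mono_neutral_left) (auto simp: in_keys_iff)

lemma monom_eval_add: "monom_eval (s + t) a = monom_eval s a * monom_eval t a"
proof -
  let ?K = "Poly_Mapping.keys s \<union> Poly_Mapping.keys t"
  have "Poly_Mapping.keys (s + t) \<subseteq> ?K" by (rule keys_add)
  then show ?thesis
    by (simp add: monom_eval_superset[of ?K] lookup_add power_add prod.distrib)
qed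

lemma monom_degree_add: "monom_degree (s + t) = monom_degree s + monom_degree t"
proof -
  let ?K = "Poly_Mapping.keys s \<union> Poly_Mapping.keys t"
  have "Poly_Mapping.keys (s + t) \<subseteq> ?K" by (rule keys_add)
  then show ?thesis
    by (simp add: monom_degree_superset[of ?K] lookup_add sum.distrib)
qed

lemma monom_eval_scale:
  "monom_eval t (\<lambda>i. c * a i) = c ^ monom_degree t * monom_eval t a"
  by (simp add: monom_eval_def monom_degree_def power_mult_distrib prod.distrib power_sum)

lemma cpoly_eval_superset:
  assumes "finite K" "Poly_Mapping.keys p \<subseteq> K"
  shows "cpoly_eval p a = (\<Sum>t\<in>K. Poly_Mapping.lookup p t * monom_eval t a)"
  unfolding cpoly_eval_def using assms
  by (intro sum.mono_neutral_left) (auto simp: in_keys_iff)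

lemma cpoly_eval_zero [simp]: "cpoly_eval 0 a = 0"
  by (simp add: cpoly_eval_def)

lemma cpoly_eval_single [simp]: "cpoly_eval (Poly_Mapping.single t c) a = c * monom_eval t a"
  by (simp add: cpoly_eval_def)

lemma cpoly_eval_add [simp]: "cpoly_eval (p + q) a = cpoly_eval p a + cpoly_eval q a"
proof -
  let ?K = "Poly_Mapping.keys p \<union> Poly_Mapping.keys q"
  have "Poly_Mapping.keys (p + q) \<subseteq> ?K" by (rule keys_add)
  then show ?thesis
    by (simp add: cpoly_eval_superset[of ?K] lookup_add algebra_simps sum.distrib)
qed

lemma cpoly_eval_sum: "cpoly_eval (sum f A) a = (\<Sum>x\<in>A. cpoly_eval (f x) a)"
  by (induction A rule: infinite_finite_induct) auto

lemma cpoly_expand: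
  fixes p :: "'i cpoly"
  shows "p = (\<Sum>t\<in>Poly_Mapping.keys p. Poly_Mapping.single t (Poly_Mapping.lookup p t))"
proof (rule poly_mapping_eqI)
  fix s
  have "(\<Sum>t\<in>Poly_Mapping.keys p.
           Poly_Mapping.lookup (Poly_Mapping.single t (Poly_Mapping.lookup p t)) s)
      = (\<Sum>t\<in>Poly_Mapping.keys p. if t = s then Poly_Mapping.lookup p s else 0)"
    by (intro sum.cong) (auto simp: lookup_single when_def)
  also have "\<dots> = Poly_Mapping.lookup p s"
    by (simp add: in_keys_iff)
  finally show "Poly_Mapping.lookup p s = Poly_Mapping.lookup
      (\<Sum>t\<in>Poly_Mapping.keys p. Poly_Mapping.single t (Poly_Mapping.lookup p t)) s"
    by (simp add: lookup_sum)
qed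

lemma cpoly_eval_mult: "cpoly_eval (p * q) a = cpoly_eval p a * cpoly_eval q a"
proof -
  have "p * q = (\<Sum>s\<in>Poly_Mapping.keys p. \<Sum>t\<in>Poly_Mapping.keys q.
      Poly_Mapping.single (s + t) (Poly_Mapping.lookup p s * Poly_Mapping.lookup q t))"
    by (subst cpoly_expand[of p], subst cpoly_expand[of q]) (simp add: sum_product mult_single)
  then have "cpoly_eval (p * q) a = (\<Sum>s\<in>Poly_Mapping.keys p. \<Sum>t\<in>Poly_Mapping.keys q.
      (Poly_Mapping.lookup p s * Poly_Mapping.lookup q t) * monom_eval (s + t) a)"
    by (simp add: cpoly_eval_sum)
  also have "\<dots> = cpoly_eval p a * cpoly_eval q a"
    by (simp add: cpoly_eval_def sum_product monom_eval_add mult_ac)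
  finally show ?thesis .
qed

lemma homogeneous_cpoly_mult:
  assumes "homogeneous_cpoly p" "homogeneous_cpoly q"
  shows "homogeneous_cpoly (p * q)"
proof -
  obtain d e where "\<forall>t\<in>Poly_Mapping.keys p. monom_degree t = d"
    "\<forall>t\<in>Poly_Mapping.keys q. monom_degree t = e"
    using assms by (auto simp: homogeneous_cpoly_def)
  then have "\<forall>t\<in>Poly_Mapping.keys (p * q). monom_degree t = d + e"
    using keys_mult[of p q] by (fastforce simp: monom_degree_add)
  then show ?thesis by (auto simp: homogeneous_cpoly_def)
qed

lemma cpoly_vars_mult: "cpoly_vars (p * q) \<subseteq> cpoly_vars p \<union> cpoly_vars q"
proof
  fix i assume "i \<in> cpoly_vars (p * q)"
  then obtain u where u: "u \<in> Poly_Mapping.keys (p * q)" "i \<in> Poly_Mapping.keys u"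
    by (auto simp: cpoly_vars_def)
  from u(1) obtain s t where st: "u = s + t" "s \<in> Poly_Mapping.keys p" "t \<in> Poly_Mapping.keys q"
    using keys_mult[of p q] by blast
  with u(2) have "i \<in> Poly_Mapping.keys s \<union> Poly_Mapping.keys t"
    using keys_add[of s t] by blast
  with st show "i \<in> cpoly_vars p \<union> cpoly_vars q"
    by (auto simp: cpoly_vars_def)
qed

lemma cpoly_eval_scale:
  assumes "\<forall>t\<in>Poly_Mapping.keys p. monom_degree t = d"
  shows "cpoly_eval p (\<lambda>i. c * a i) = c ^ d * cpoly_eval p a"
  using assms by (simp add: cpoly_eval_def monom_eval_scale sum_distrib_left mult_ac)

lemma homogeneous_vanish_iff:
  assumes "homogeneous_cpoly p" "P \<in> proj_space I" "a \<in> P"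
  shows "(\<forall>b\<in>P. cpoly_eval p b = 0) \<longleftrightarrow> cpoly_eval p a = 0"
proof -
  obtain d where d: "\<forall>t\<in>Poly_Mapping.keys p. monom_degree t = d"
    using assms(1) by (auto simp: homogeneous_cpoly_def)
  have "cpoly_eval p b = 0" if "cpoly_eval p a = 0" "b \<in> P" for b
  proof -
    have "(a, b) \<in> proj_rel I"
      using assms(2,3) that(2) equiv_proj_rel[of I] unfolding proj_space_def
      by (metis in_quotient_imp_in_rel empty_subsetI insert_subset)
    then obtain c where "b = (\<lambda>i. c * a i)" by (auto simp: proj_rel_def)
    then show ?thesis using that(1) cpoly_eval_scale[OF d] by simp
  qed
  then show ?thesis using assms(3) by blast
qed

lemma proj_space_nonempty_class: "P \<in> proj_space I \<Longrightarrow> P \<noteq> {}"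
  unfolding proj_space_def using equiv_proj_rel[of I] in_quotient_imp_non_empty by blast

lemma proj_algebraic_Inter:
  assumes "\<forall>Z\<in>\<Z>. proj_algebraic I Z"
  shows "proj_algebraic I (proj_space I \<inter> \<Inter>\<Z>)"
proof -
  obtain S where S: "\<forall>Z\<in>\<Z>. (\<forall>p\<in>S Z. homogeneous_cpoly p \<and> cpoly_vars p \<subseteq> I) \<and>
      Z = proj_zero_locus I (S Z)"
    using assms unfolding proj_algebraic_def by metis
  have mem: "P \<in> Z \<longleftrightarrow> P \<in> proj_zero_locus I (S Z)" if "Z \<in> \<Z>" for Z P
    using S that by blast
  have "proj_space I \<inter> \<Inter>\<Z> = proj_zero_locus I (\<Union>Z\<in>\<Z>. S Z)"
  proof (intro equalityI subsetI)
    fix P assume "P \<in> proj_space I \<inter> \<Inter>\<Z>"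
    then show "P \<in> proj_zero_locus I (\<Union>Z\<in>\<Z>. S Z)"
      using mem by (fastforce simp: proj_zero_locus_def)
  next
    fix P assume P: "P \<in> proj_zero_locus I (\<Union>Z\<in>\<Z>. S Z)"
    have "P \<in> Z" if "Z \<in> \<Z>" for Z
      unfolding mem[OF that] using P that by (auto simp: proj_zero_locus_def)
    then show "P \<in> proj_space I \<inter> \<Inter>\<Z>" using P by (auto simp: proj_zero_locus_def)
  qed
  with S show ?thesis unfolding proj_algebraic_def by (intro exI[of _ "\<Union>Z\<in>\<Z>. S Z"]) blast
qed

lemma proj_algebraic_Un:
  assumes "proj_algebraic I Y" "proj_algebraic I Z"
  shows "proj_algebraic I (Y \<union> Z)"
proof -
  obtain S T where
    S: "\<forall>p\<in>S. homogeneous_cpoly p \<and> cpoly_vars p \<subseteq> I" "Y = proj_zero_locus I S" and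
    T: "\<forall>p\<in>T. homogeneous_cpoly p \<and> cpoly_vars p \<subseteq> I" "Z = proj_zero_locus I T"
    using assms unfolding proj_algebraic_def by blast
  let ?U = "{p * q | p q. p \<in> S \<and> q \<in> T}"
  have U: "\<forall>r\<in>?U. homogeneous_cpoly r \<and> cpoly_vars r \<subseteq> I"
    using S(1) T(1) cpoly_vars_mult by (fastforce intro: homogeneous_cpoly_mult)
  have "Y \<union> Z = proj_zero_locus I ?U"
  proof (intro equalityI subsetI)
    fix P assume "P \<in> Y \<union> Z"
    then show "P \<in> proj_zero_locus I ?U"
      unfolding S(2) T(2) by (auto simp: proj_zero_locus_def cpoly_eval_mult)
  next
    fix P assume P: "P \<in> proj_zero_locus I ?U"
    then have PI: "P \<in> proj_space I" by (simp add: proj_zero_locus_def)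
    then obtain a where a: "a \<in> P" using proj_space_nonempty_class by blast
    have prod: "cpoly_eval p a * cpoly_eval q a = 0" if "p \<in> S" "q \<in> T" for p q
      using P a that unfolding proj_zero_locus_def by (force simp: cpoly_eval_mult[symmetric])
    have "(\<forall>p\<in>S. cpoly_eval p a = 0) \<or> (\<forall>q\<in>T. cpoly_eval q a = 0)"
      using prod by (metis mult_eq_0_iff)
    then show "P \<in> Y \<union> Z"
      unfolding S(2) T(2) proj_zero_locus_def
      using S(1) T(1) PI a homogeneous_vanish_iff[OF _ PI a] by blast
  qed
  with U show ?thesis unfolding proj_algebraic_def by blast
qed

lemma proj_algebraic_subset: "proj_algebraic I Z \<Longrightarrow> Z \<subseteq> proj_space I"
  by (auto simp: proj_algebraic_def proj_zero_locus_def)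

lemma istopology_zariski:
  "istopology (\<lambda>U. U \<subseteq> proj_space I \<and> proj_algebraic I (proj_space I - U))"
  unfolding istopology_def
proof (intro conjI allI impI)
  fix U V
  assume U: "U \<subseteq> proj_space I \<and> proj_algebraic I (proj_space I - U)"
    and V: "V \<subseteq> proj_space I \<and> proj_algebraic I (proj_space I - V)"
  show "U \<inter> V \<subseteq> proj_space I" using U by blast
  show "proj_algebraic I (proj_space I - U \<inter> V)"
    using U V proj_algebraic_Un[of I "proj_space I - U" "proj_space I - V"]
    by (simp add: Diff_Int)
next
  fix \<K> assume K: "\<forall>U\<in>\<K>. U \<subseteq> proj_space I \<and> proj_algebraic I (proj_space I - U)"
  show "\<Union>\<K> \<subseteq> proj_space I" using K by blast
  have "proj_space I - \<Union>\<K> = proj_space I \<inter> \<Inter>((\<lambda>U. proj_space I - U) ` \<K>)" by blast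
  then show "proj_algebraic I (proj_space I - \<Union>\<K>)"
    using K proj_algebraic_Inter[of "(\<lambda>U. proj_space I - U) ` \<K>" I] by simp
qed

lemma openin_zariski:
  "openin (zariski_topology I) U \<longleftrightarrow> U \<subseteq> proj_space I \<and> proj_algebraic I (proj_space I - U)"
  unfolding zariski_topology_def by (simp add: topology_inverse'[OF istopology_zariski])

lemma proj_algebraic_empty: "proj_algebraic I {}"
proof -
  let ?p = "Poly_Mapping.single 0 1 :: 'a cpoly"
  have "{} = proj_zero_locus I {?p}"
    using proj_space_nonempty_class by (fastforce simp: proj_zero_locus_def monom_eval_def simp del: single_one)
  moreover have "homogeneous_cpoly ?p" "cpoly_vars ?p \<subseteq> I"
    by (simp_all add: homogeneous_cpoly_def cpoly_vars_def del: single_one)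
  ultimately show ?thesis unfolding proj_algebraic_def by blast
qed

lemma topspace_zariski [simp]: "topspace (zariski_topology I) = proj_space I"
proof
  show "topspace (zariski_topology I) \<subseteq> proj_space I"
    using openin_topspace[of "zariski_topology I"] unfolding openin_zariski by blast
  have "openin (zariski_topology I) (proj_space I)"
    by (simp add: openin_zariski proj_algebraic_empty)
  then show "proj_space I \<subseteq> topspace (zariski_topology I)" by (rule openin_subset)
qed

lemma closedin_zariski: "closedin (zariski_topology I) Z \<longleftrightarrow> proj_algebraic I Z"
  using proj_algebraic_subset[of I Z]
  by (auto simp: closedin_def openin_zariski double_diff)

definition hm_indices :: "nat \<Rightarrow> nat \<Rightarrow> nat list set" where
  "hm_indices n m = {js. length js = m \<and> set js \<subseteq> {1..n}}"

lemma card_hm_indices: "card (hm_indices n m) = n ^ m"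
  using card_lists_length_eq[of "{1..n}" m] by (simp add: hm_indices_def conj_commute)

text \<open>The \<open>i\<close>-th component of \<open>A x\<^sup>m\<^sup>-\<^sup>1\<close>.\<close>

definition hm_apply :: "nat \<Rightarrow> nat \<Rightarrow> (nat list \<Rightarrow> complex) \<Rightarrow> (nat \<Rightarrow> complex) \<Rightarrow> nat \<Rightarrow> complex" where
  "hm_apply n m A x i = (\<Sum>js\<in>hm_indices n (m - 1). A (i # js) * prod_list (map x js))"

definition irregular :: "nat \<Rightarrow> nat \<Rightarrow> (nat list \<Rightarrow> complex) \<Rightarrow> bool" where
  "irregular n m A \<longleftrightarrow>
     (\<exists>x \<in> coord_space {1..n} - {\<lambda>_. 0}.
        (\<forall>i\<in>{1..n}. hm_apply n m A x i = 0) \<and> (\<Sum>i=1..n. (x i)\<^sup>2) = 0)"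

definition irregular_classes :: "nat \<Rightarrow> nat \<Rightarrow> (nat list \<Rightarrow> complex) set set" where
  "irregular_classes n m =
     {proj_class (hm_indices n m) A | A.
        A \<in> coord_space (hm_indices n m) - {\<lambda>_. 0} \<and> irregular n m A}"

end

theory Submission
  imports Defs "HOL-Computational_Algebra.Polynomial" "HOL-Library.FuncSet"
begin

text \<open>Let \<open>Z\<close> be an irreducible closed subset of the closure of the irregular classes and let \<open>p\<close> be a
  point outside \<open>Z\<close>. The closure \<open>D\<close> of the cone over \<open>Z\<close> with vertex \<open>p\<close> is irreducible and strictly
  larger than \<open>Z\<close>, so \<open>Z \<subset> D\<close> extends by the whole space to a chain of length \<open>2\<close> once \<open>D\<close> is a proper subset. This
  holds because the hypermatrices \<open>A + t p\<close> with \<open>A\<close> irregular are covered by the images of finitely many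
  polynomial maps in \<open>n\<^sup>m - 1\<close> parameters (\<open>n - 2\<close> for an isotropic direction \<open>x\<close>, \<open>n\<^sup>m - n\<close> for the
  \<open>A\<close> with \<open>A x\<^sup>m\<^sup>-\<^sup>1 = 0\<close>, and one for \<open>t\<close>), and a polynomial map with fewer parameters than coordinates
  satisfies a nontrivial polynomial relation.\<close>

section \<open>Polynomial functions\<close>

text \<open>Bounding each exponent separately, not the total degree, makes the box a product: its
  size is an exact power, and its monomials read as digit strings in base
  \<open>E + 1\<close>.\<close>

definition expo_box :: "'i set \<Rightarrow> nat \<Rightarrow> ('i \<Rightarrow>\<^sub>0 nat) set" where
  "expo_box J E = {t. Poly_Mapping.keys t \<subseteq> J \<and> (\<forall>j. Poly_Mapping.lookup t j \<le> E)}"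

definition poly_fun_le :: "'i set \<Rightarrow> nat \<Rightarrow> (('i \<Rightarrow> complex) \<Rightarrow> complex) \<Rightarrow> bool" where
  "poly_fun_le J E f \<longleftrightarrow> (\<exists>p. Poly_Mapping.keys p \<subseteq> expo_box J E \<and> cpoly_eval p = f)"

text \<open>Working with functions instead of polynomials turns substitution into composition; only
  the existence of a representing polynomial has to be carried along.\<close>

definition poly_fun :: "'i set \<Rightarrow> (('i \<Rightarrow> complex) \<Rightarrow> complex) \<Rightarrow> bool" where
  "poly_fun J f \<longleftrightarrow> (\<exists>p. cpoly_vars p \<subseteq> J \<and> cpoly_eval p = f)"

lemma poly_fun_leI:
  "Poly_Mapping.keys p \<subseteq> expo_box J E \<Longrightarrow> (\<And>s. cpoly_eval p s = f s) \<Longrightarrow> poly_fun_le J E f"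
  by (auto simp: poly_fun_le_def fun_eq_iff)

lemma poly_fun_le_mono: "poly_fun_le J E f \<Longrightarrow> E \<le> E' \<Longrightarrow> poly_fun_le J E' f"
  unfolding poly_fun_le_def expo_box_def by (blast intro: order_trans)

lemma poly_fun_le_const: "poly_fun_le J 0 (\<lambda>_. c)"
  by (rule poly_fun_leI[of "Poly_Mapping.single 0 c"])
     (auto simp: expo_box_def monom_eval_def split: if_splits)

lemma poly_fun_le_var: "j \<in> J \<Longrightarrow> poly_fun_le J 1 (\<lambda>s. s j)"
  by (rule poly_fun_leI[of "Poly_Mapping.single (Poly_Mapping.single j 1) 1"])
     (auto simp: expo_box_def monom_eval_def lookup_single when_def split: if_splits)

lemma poly_fun_le_add:
  assumes "poly_fun_le J E f" "poly_fun_le J E g"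
  shows "poly_fun_le J E (\<lambda>s. f s + g s)"
proof -
  obtain p q where "Poly_Mapping.keys p \<subseteq> expo_box J E" "Poly_Mapping.keys q \<subseteq> expo_box J E"
    "cpoly_eval p = f" "cpoly_eval q = g"
    using assms by (auto simp: poly_fun_le_def)
  then show ?thesis
    using keys_add[of p q] by (intro poly_fun_leI[of "p + q"]) auto
qed

lemma poly_fun_le_mult:
  assumes "poly_fun_le J E f" "poly_fun_le J E' g"
  shows "poly_fun_le J (E + E') (\<lambda>s. f s * g s)"
proof -
  obtain p q where pq: "Poly_Mapping.keys p \<subseteq> expo_box J E" "Poly_Mapping.keys q \<subseteq> expo_box J E'"
    "cpoly_eval p = f" "cpoly_eval q = g"
    using assms by (auto simp: poly_fun_le_def)
  have "Poly_Mapping.keys (p * q) \<subseteq> expo_box J (E + E')"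
  proof
    fix u assume "u \<in> Poly_Mapping.keys (p * q)"
    then obtain s t where u: "u = s + t" "s \<in> expo_box J E" "t \<in> expo_box J E'"
      using keys_mult[of p q] pq by blast
    then show "u \<in> expo_box J (E + E')"
      using keys_add[of s t] by (auto simp: expo_box_def lookup_add intro!: add_mono)
  qed
  then show ?thesis
    using pq by (intro poly_fun_leI[of "p * q"]) (auto simp: cpoly_eval_mult)
qed

lemma poly_fun_le_power: "poly_fun_le J E f \<Longrightarrow> poly_fun_le J (k * E) (\<lambda>s. f s ^ k)"
  by (induction k) (auto simp: poly_fun_le_const intro: poly_fun_le_mult)

lemma poly_fun_le_prod:
  assumes "finite A" "\<And>i. i \<in> A \<Longrightarrow> poly_fun_le J (E i) (f i)"
  shows "poly_fun_le J (\<Sum>i\<in>A. E i) (\<lambda>s. \<Prod>i\<in>A. f i s)"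
  using assms by (induction rule: finite_induct) (auto simp: poly_fun_le_const intro: poly_fun_le_mult)

lemma poly_fun_le_imp_poly_fun: "poly_fun_le J E f \<Longrightarrow> poly_fun J f"
  by (fastforce simp: poly_fun_le_def poly_fun_def cpoly_vars_def expo_box_def)

lemma poly_fun_imp_le:
  assumes "poly_fun J f"
  obtains E where "poly_fun_le J E f"
proof -
  obtain p where p: "cpoly_vars p \<subseteq> J" "cpoly_eval p = f"
    using assms by (auto simp: poly_fun_def)
  \<comment> \<open>The sum of the degrees of the finitely many monomials majorises every exponent
    at once.\<close>
  define E where "E = (\<Sum>t\<in>Poly_Mapping.keys p. monom_degree t)"
  have "Poly_Mapping.lookup t j \<le> E" if t: "t \<in> Poly_Mapping.keys p" for t j
  proof -
    have "Poly_Mapping.lookup t j \<le> monom_degree t"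
      unfolding monom_degree_def
      by (cases "j \<in> Poly_Mapping.keys t") (simp_all add: member_le_sum in_keys_iff)
    also have "\<dots> \<le> E"
      unfolding E_def using t by (intro member_le_sum) auto
    finally show ?thesis .
  qed
  then have "Poly_Mapping.keys p \<subseteq> expo_box J E"
    using p(1) by (auto simp: cpoly_vars_def expo_box_def)
  then show ?thesis using p(2) that by (auto simp: poly_fun_le_def)
qed

lemma poly_fun_const: "poly_fun J (\<lambda>_. c)"
  by (rule poly_fun_le_imp_poly_fun[OF poly_fun_le_const])

lemma poly_fun_var: "j \<in> J \<Longrightarrow> poly_fun J (\<lambda>s. s j)"
  by (rule poly_fun_le_imp_poly_fun[OF poly_fun_le_var])

lemma poly_fun_mult: "poly_fun J f \<Longrightarrow> poly_fun J g \<Longrightarrow> poly_fun J (\<lambda>s. f s * g s)"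
  by (elim poly_fun_imp_le) (rule poly_fun_le_imp_poly_fun[OF poly_fun_le_mult])

lemma poly_fun_add:
  assumes "poly_fun J f" "poly_fun J g"
  shows "poly_fun J (\<lambda>s. f s + g s)"
proof -
  obtain E E' where "poly_fun_le J E f" "poly_fun_le J E' g"
    using assms by (meson poly_fun_imp_le)
  then have "poly_fun_le J (max E E') f" "poly_fun_le J (max E E') g"
    by (auto intro: poly_fun_le_mono)
  then show ?thesis by (blast intro: poly_fun_le_add poly_fun_le_imp_poly_fun)
qed

lemma poly_fun_diff: "poly_fun J f \<Longrightarrow> poly_fun J g \<Longrightarrow> poly_fun J (\<lambda>s. f s - g s)"
  using poly_fun_add[of J f "\<lambda>s. (-1) * g s"] poly_fun_mult[OF poly_fun_const[of J "-1"], of g]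
  by simp

lemma poly_fun_sum:
  "(\<And>i. i \<in> A \<Longrightarrow> poly_fun J (f i)) \<Longrightarrow> poly_fun J (\<lambda>s. \<Sum>i\<in>A. f i s)"
  by (induction A rule: infinite_finite_induct) (auto intro: poly_fun_const poly_fun_add)

lemma poly_fun_prod:
  "(\<And>i. i \<in> A \<Longrightarrow> poly_fun J (f i)) \<Longrightarrow> poly_fun J (\<lambda>s. \<Prod>i\<in>A. f i s)"
  by (induction A rule: infinite_finite_induct) (auto intro: poly_fun_const poly_fun_mult)

lemma poly_fun_power: "poly_fun J f \<Longrightarrow> poly_fun J (\<lambda>s. f s ^ k)"
  by (induction k) (auto intro: poly_fun_const poly_fun_mult)

lemma poly_fun_prod_list:
  "(\<And>i. i \<in> set is \<Longrightarrow> poly_fun J (f i)) \<Longrightarrow> poly_fun J (\<lambda>s. prod_list (map (\<lambda>i. f i s) is))"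
  by (induction "is") (auto intro: poly_fun_const poly_fun_mult)

lemmas poly_fun_intros = poly_fun_const poly_fun_var poly_fun_mult poly_fun_add poly_fun_diff
  poly_fun_sum poly_fun_prod poly_fun_power poly_fun_prod_list

lemma poly_fun_compose:
  assumes "poly_fun I f" "\<And>i. i \<in> I \<Longrightarrow> poly_fun J (g i)"
  shows "poly_fun J (\<lambda>s. f (\<lambda>i. g i s))"
proof -
  obtain p where p: "cpoly_vars p \<subseteq> I" "cpoly_eval p = f"
    using assms(1) by (auto simp: poly_fun_def)
  have "poly_fun J (\<lambda>s. \<Sum>t\<in>Poly_Mapping.keys p. Poly_Mapping.lookup p t *
      (\<Prod>i\<in>Poly_Mapping.keys t. g i s ^ Poly_Mapping.lookup t i))"
    using p(1) by (intro poly_fun_intros assms(2)) (auto simp: cpoly_vars_def)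
  then show ?thesis by (simp add: p(2)[symmetric] cpoly_eval_def monom_eval_def)
qed

lemma poly_fun_cong:
  assumes "poly_fun I f" "\<And>i. i \<in> I \<Longrightarrow> a i = b i"
  shows "f a = f b"
proof -
  obtain p where p: "cpoly_vars p \<subseteq> I" "cpoly_eval p = f"
    using assms(1) by (auto simp: poly_fun_def)
  have "monom_eval t a = monom_eval t b" if "t \<in> Poly_Mapping.keys p" for t
    unfolding monom_eval_def using p(1) that
    by (intro prod.cong refl arg_cong2[where f = "(^)"] assms(2)) (auto simp: cpoly_vars_def)
  then show ?thesis by (simp add: p(2)[symmetric] cpoly_eval_def)
qed

text \<open>Restriction to a line reduces nonvanishing in many variables to the finiteness of the
  roots of a univariate polynomial.\<close>

lemma poly_fun_on_line:
  assumes "poly_fun I f"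
  obtains q where "\<And>t. f (\<lambda>i. a i + t * d i) = poly q t"
proof -
  obtain p where p: "cpoly_vars p \<subseteq> I" "cpoly_eval p = f"
    using assms(1) by (auto simp: poly_fun_def)
  let ?q = "\<Sum>t\<in>Poly_Mapping.keys p. Polynomial.smult (Poly_Mapping.lookup p t)
      (\<Prod>i\<in>Poly_Mapping.keys t. [:a i, d i:] ^ Poly_Mapping.lookup t i)"
  have "f (\<lambda>i. a i + t * d i) = poly ?q t" for t
    by (simp add: p(2)[symmetric] cpoly_eval_def monom_eval_def poly_sum poly_prod)
  then show ?thesis by (rule that)
qed

section \<open>Algebraic dependence\<close>

text \<open>Gaussian elimination, by induction on the equations: an identically zero equation is
  dropped; any other is solved for one unknown, which lowers both counts by one.\<close>

lemma underdetermined_system: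
  fixes M :: "'k \<Rightarrow> 's \<Rightarrow> 'a::field"
  assumes "finite K" "finite S" "card K < card S"
  shows "\<exists>c. (\<exists>s\<in>S. c s \<noteq> 0) \<and> (\<forall>k\<in>K. (\<Sum>s\<in>S. c s * M k s) = 0)"
  using assms
proof (induction K arbitrary: S M rule: finite_induct)
  case empty
  then have "S \<noteq> {}" by auto
  then show ?case by (intro exI[of _ "\<lambda>_. 1"]) auto
next
  case (insert k K)
  show ?case
  proof (cases "\<forall>s\<in>S. M k s = 0")
    case True
    obtain c where "\<exists>s\<in>S. c s \<noteq> 0" "\<forall>k\<in>K. (\<Sum>s\<in>S. c s * M k s) = 0"
      using insert.IH[of S M] insert.prems insert.hyps by auto
    with True show ?thesis by (intro exI[of _ c]) auto
  next
    case False
    then obtain s0 where s0: "s0 \<in> S" "M k s0 \<noteq> 0" by auto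
    define S' where "S' = S - {s0}"
    have S': "S = insert s0 S'" "s0 \<notin> S'" "finite S'"
      using s0 insert.prems by (auto simp: S'_def)
    then have "card K < card S'"
      using insert.prems insert.hyps by simp
    then obtain c where c: "\<exists>s\<in>S'. c s \<noteq> 0"
      "\<forall>j\<in>K. (\<Sum>s\<in>S'. c s * (M j s - M j s0 * M k s / M k s0)) = 0"
      using insert.IH[of S' "\<lambda>j s. M j s - M j s0 * M k s / M k s0"] S'(3) by auto
    \<comment> \<open>The pivot unknown \<open>s0\<close> takes the value that solves equation
      \<open>k\<close>; inserting it in another equation gives exactly the eliminated equation that
      \<open>c\<close> satisfies.\<close>
    define d where "d = c(s0 := - (\<Sum>s\<in>S'. c s * M k s) / M k s0)"
    have d: "(\<Sum>s\<in>S. d s * M j s) = d s0 * M j s0 + (\<Sum>s\<in>S'. c s * M j s)" for j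
      using S' by (auto simp: d_def intro!: sum.cong)
    have "(\<Sum>s\<in>S. d s * M k s) = 0"
      unfolding d using s0 by (simp add: d_def)
    moreover have "(\<Sum>s\<in>S. d s * M j s) = 0" if "j \<in> K" for j
    proof -
      have "(\<Sum>s\<in>S'. c s * M j s) = (\<Sum>s\<in>S'. c s * M k s) * (M j s0 / M k s0)"
        using c(2) that
        by (simp add: right_diff_distrib sum_subtractf sum_distrib_left sum_divide_distrib mult_ac)
      then show ?thesis unfolding d by (simp add: d_def)
    qed
    moreover have "\<exists>s\<in>S. d s \<noteq> 0" using c(1) S' by (auto simp: d_def)
    ultimately show ?thesis by auto
  qed
qed

section \<open>Counting and separating the monomials of a box\<close>

lemma bij_betw_expo_box:
  assumes "finite J"
  shows "bij_betw (\<lambda>t. restrict (Poly_Mapping.lookup t) J) (expo_box J E) (Pi\<^sub>E J (\<lambda>_. {..E}))"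
proof (rule bij_betwI')
  fix s t assume "s \<in> expo_box J E" "t \<in> expo_box J E"
  then have "Poly_Mapping.keys s \<subseteq> J" "Poly_Mapping.keys t \<subseteq> J" by (auto simp: expo_box_def)
  then have out: "Poly_Mapping.lookup s j = Poly_Mapping.lookup t j" if "j \<notin> J" for j
    using that by (metis in_keys_iff subsetD)
  show "(restrict (Poly_Mapping.lookup s) J = restrict (Poly_Mapping.lookup t) J) = (s = t)"
  proof
    assume eq: "restrict (Poly_Mapping.lookup s) J = restrict (Poly_Mapping.lookup t) J"
    have "Poly_Mapping.lookup s j = Poly_Mapping.lookup t j" for j
      using out[of j] fun_cong[OF eq, of j] by (cases "j \<in> J") auto
    then show "s = t" by (rule poly_mapping_eqI)
  qed simp
next
  fix t assume "t \<in> expo_box J E"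
  then show "restrict (Poly_Mapping.lookup t) J \<in> Pi\<^sub>E J (\<lambda>_. {..E})"
    by (auto simp: expo_box_def)
next
  fix g assume g: "g \<in> Pi\<^sub>E J (\<lambda>_. {..E})"
  let ?h = "\<lambda>j. if j \<in> J then g j else 0"
  have "finite {j. ?h j \<noteq> 0}"
    by (rule finite_subset[OF _ assms]) auto
  then have h: "Poly_Mapping.lookup (Abs_poly_mapping ?h) = ?h"
    by (rule Abs_poly_mapping_inverse[OF CollectI])
  show "\<exists>t\<in>expo_box J E. g = restrict (Poly_Mapping.lookup t) J"
    using g by (intro bexI[of _ "Abs_poly_mapping ?h"])
      (auto simp: h expo_box_def in_keys_iff fun_eq_iff PiE_iff extensional_def split: if_splits)
qed

lemma expo_box_finite: "finite J \<Longrightarrow> finite (expo_box J E)"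
  using bij_betw_finite[OF bij_betw_expo_box, of J E] by (simp add: finite_PiE)

lemma card_expo_box: "finite J \<Longrightarrow> card (expo_box J E) = (E + 1) ^ card J"
  using bij_betw_same_card[OF bij_betw_expo_box, of J E] by (simp add: card_PiE)

text \<open>The lowest digits agree modulo \<open>b\<close>; cancelling them and dividing by
  \<open>b\<close> leaves expansions with one digit fewer.\<close>

lemma base_expansion_unique:
  fixes f g :: "nat \<Rightarrow> nat"
  assumes "(\<Sum>k<N. f k * b ^ k) = (\<Sum>k<N. g k * b ^ k)" "\<And>k. k < N \<Longrightarrow> f k < b" "\<And>k. k < N \<Longrightarrow> g k < b"
    "k < N"
  shows "f k = g k"
  using assms
proof (induction N arbitrary: f g k)
  case (Suc N)
  have split: "(\<Sum>k<Suc N. f k * b ^ k) = f 0 + b * (\<Sum>k<N. f (Suc k) * b ^ k)" for f :: "nat \<Rightarrow> nat"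
    by (simp add: sum.lessThan_Suc_shift sum_distrib_left mult_ac del: sum.lessThan_Suc)
  have eq: "f 0 + b * (\<Sum>k<N. f (Suc k) * b ^ k) = g 0 + b * (\<Sum>k<N. g (Suc k) * b ^ k)"
    using Suc.prems(1) unfolding split .
  have lt: "f 0 < b" "g 0 < b" using Suc.prems by auto
  have 0: "f 0 = g 0"
    using arg_cong[OF eq, of "\<lambda>x. x mod b"] lt by simp
  have "(\<Sum>k<N. f (Suc k) * b ^ k) = (\<Sum>k<N. g (Suc k) * b ^ k)"
    using eq 0 lt by simp
  then have "f (Suc k) = g (Suc k)" if "k < N" for k
    using Suc.IH[of "\<lambda>k. f (Suc k)" "\<lambda>k. g (Suc k)"] Suc.prems(2,3) that by auto
  with 0 show ?case using Suc.prems(4) by (cases k) auto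
qed auto

lemma complex_poly_nonroot_avoiding:
  fixes q :: "complex poly"
  assumes "q \<noteq> 0" "finite X"
  obtains x where "poly q x \<noteq> 0" "x \<notin> X"
proof -
  have "finite ({x. poly q x = 0} \<union> X)"
    using assms poly_roots_finite by auto
  then obtain x where "x \<notin> {x. poly q x = 0} \<union> X"
    using ex_new_if_finite[OF infinite_UNIV_char_0] by blast
  then show ?thesis using that by auto
qed

text \<open>Kronecker substitution \<open>a\<^sub>i = x^((E + 1)^i)\<close> sends distinct monomials of the box to distinct
  powers of \<open>x\<close>.\<close>

lemma box_monomials_independent:
  assumes "finite I" "I \<noteq> {}" "t0 \<in> expo_box I E" "c t0 \<noteq> 0"
  shows "\<exists>a\<in>coord_space I - {\<lambda>_. 0}. (\<Sum>t\<in>expo_box I E. c t * monom_eval t a) \<noteq> 0"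
proof -
  obtain h where h: "bij_betw h {..<card I} I"
    using ex_bij_betw_nat_finite[OF assms(1)] by (auto simp: atLeast0LessThan)
  define code where "code t = (\<Sum>k<card I. Poly_Mapping.lookup t (h k) * (E + 1) ^ k)" for t
  have inj: "inj_on code (expo_box I E)"
  proof (rule inj_onI)
    fix s t assume st: "s \<in> expo_box I E" "t \<in> expo_box I E" "code s = code t"
    then have lt: "Poly_Mapping.lookup s i < E + 1" "Poly_Mapping.lookup t i < E + 1" for i
      by (auto simp: expo_box_def le_imp_less_Suc)
    have k: "Poly_Mapping.lookup s (h k) = Poly_Mapping.lookup t (h k)" if "k < card I" for k
      by (rule base_expansion_unique[OF st(3)[unfolded code_def] lt that])
    have "Poly_Mapping.lookup s i = Poly_Mapping.lookup t i" for i
    proof (cases "i \<in> I")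
      case True
      then obtain k where "k < card I" "i = h k"
        using h by (auto simp: bij_betw_def)
      with k show ?thesis by simp
    next
      case False
      then have "i \<notin> Poly_Mapping.keys s" "i \<notin> Poly_Mapping.keys t"
        using st(1,2) by (auto simp: expo_box_def)
      then show ?thesis by (simp add: in_keys_iff)
    qed
    then show "s = t" by (rule poly_mapping_eqI)
  qed
  \<comment> \<open>After the substitution the linear combination is the value of \<open>q\<close>
    at \<open>x\<close>. Since \<open>code\<close> is injective on the box, no two terms merge and
    the coefficient \<open>c t0\<close> survives.\<close>
  define q where "q = (\<Sum>t\<in>expo_box I E. Polynomial.monom (c t) (code t))"
  have "coeff q (code t0) = (\<Sum>t\<in>expo_box I E. if t = t0 then c t else 0)"
    unfolding q_def coeff_sum using inj assms(3)
    by (intro sum.cong) (auto simp: inj_on_def)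
  also have "\<dots> = c t0"
    using assms(3) expo_box_finite[OF assms(1)] by simp
  finally have "q \<noteq> 0" using assms(4) by auto
  then obtain x where x: "poly q x \<noteq> 0" "x \<noteq> 0"
    using complex_poly_nonroot_avoiding[of q "{0}"] by auto
  define a where "a = (\<lambda>i. if i \<in> I then x ^ ((E + 1) ^ the_inv_into {..<card I} h i) else 0)"
  have ah: "a (h k) = x ^ ((E + 1) ^ k)" if "k < card I" for k
    using h that by (auto simp: a_def bij_betw_def the_inv_into_f_f)
  have "monom_eval t a = x ^ code t" if "t \<in> expo_box I E" for t
  proof -
    have "monom_eval t a = (\<Prod>i\<in>I. a i ^ Poly_Mapping.lookup t i)"
      using assms(1) that by (intro monom_eval_superset) (auto simp: expo_box_def)
    also have "\<dots> = (\<Prod>k<card I. a (h k) ^ Poly_Mapping.lookup t (h k))"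
      by (rule prod.reindex_bij_betw[OF h, symmetric])
    also have "\<dots> = x ^ code t"
      unfolding code_def power_sum by (intro prod.cong) (auto simp: ah power_mult[symmetric] mult.commute)
    finally show ?thesis .
  qed
  then have "(\<Sum>t\<in>expo_box I E. c t * monom_eval t a) = poly q x"
    by (simp add: q_def poly_sum poly_monom)
  moreover have "a \<in> coord_space I - {\<lambda>_. 0}"
    using assms(2) x(2) by (auto simp: coord_space_def a_def fun_eq_iff)
  ultimately show ?thesis using x(1) by (intro bexI[of _ a]) simp_all
qed

text \<open>With exponents at most \<open>D\<close> there are \<open>(D + 1)\<^sup>N\<close> monomials in \<open>N = card I\<close> variables, whose
  pullbacks along \<open>g\<close> (of degree at most \<open>e\<close> in each parameter) lie in a space of dimension at most
  \<open>(N D e + 1)^card J\<close>, which is smaller for large \<open>D\<close>.\<close>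

lemma algebraic_dependence:
  assumes I: "finite I" and J: "finite J" and lt: "card J < card I"
    and g: "\<And>i. i \<in> I \<Longrightarrow> poly_fun J (g i)"
  shows "\<exists>f. poly_fun I f \<and> (\<forall>s. f (\<lambda>i. g i s) = 0) \<and> (\<exists>a\<in>coord_space I - {\<lambda>_. 0}. f a \<noteq> 0)"
proof -
  have "\<forall>i\<in>I. \<exists>E. poly_fun_le J E (g i)"
    using g by (meson poly_fun_imp_le)
  then obtain E where E: "\<And>i. i \<in> I \<Longrightarrow> poly_fun_le J (E i) (g i)" by metis
  define e where "e = sum E I"
  have e: "poly_fun_le J e (g i)" if "i \<in> I" for i
    using E[OF that] by (rule poly_fun_le_mono) (use I that in \<open>auto simp: e_def intro: member_le_sum\<close>)
  define N where "N = card I"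
  \<comment> \<open>This choice of \<open>D\<close> gives
    \<open>(R + 1) ^ card J \<le> D * (D + 1) ^ card J\<close>, which is less than
    \<open>(D + 1) ^ Suc (card J)\<close>, and \<open>Suc (card J) \<le> N\<close>.\<close>
  define D where "D = (N * e + 1) ^ card J"
  define R where "R = N * (D * e)"
  have "R + 1 \<le> (N * e + 1) * (D + 1)" by (simp add: R_def algebra_simps)
  then have "(R + 1) ^ card J \<le> ((N * e + 1) * (D + 1)) ^ card J" by (intro power_mono) auto
  also have "\<dots> = D * (D + 1) ^ card J" by (simp only: power_mult_distrib D_def[symmetric])
  also have "\<dots> < (D + 1) ^ Suc (card J)" by simp
  also have "\<dots> \<le> (D + 1) ^ N" using lt by (intro power_increasing) (auto simp: N_def)
  finally have card: "card (expo_box J R) < card (expo_box I D)"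
    using I J by (simp add: card_expo_box N_def)
  have "poly_fun_le J R (\<lambda>s. monom_eval t (\<lambda>i. g i s))" if t: "t \<in> expo_box I D" for t
  proof -
    have "poly_fun_le J (\<Sum>i\<in>I. Poly_Mapping.lookup t i * e)
        (\<lambda>s. \<Prod>i\<in>I. g i s ^ Poly_Mapping.lookup t i)"
      using I e by (intro poly_fun_le_prod poly_fun_le_power) auto
    moreover have "(\<Sum>i\<in>I. Poly_Mapping.lookup t i * e) \<le> (\<Sum>i\<in>I. D * e)"
      using t by (intro sum_mono mult_right_mono) (auto simp: expo_box_def)
    moreover have "monom_eval t (\<lambda>i. g i s) = (\<Prod>i\<in>I. g i s ^ Poly_Mapping.lookup t i)" for s
      using I t by (intro monom_eval_superset) (auto simp: expo_box_def)
    ultimately show ?thesis using poly_fun_le_mono by (simp add: R_def N_def)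
  qed
  then obtain P where P: "\<And>t. t \<in> expo_box I D \<Longrightarrow> Poly_Mapping.keys (P t) \<subseteq> expo_box J R"
    "\<And>t. t \<in> expo_box I D \<Longrightarrow> cpoly_eval (P t) = (\<lambda>s. monom_eval t (\<lambda>i. g i s))"
    unfolding poly_fun_le_def by metis
  \<comment> \<open>One unknown per monomial in the coordinates, one equation per monomial in the
    parameters: \<open>c\<close> is a linear dependence among the pullbacks.\<close>
  obtain c where c: "\<exists>t\<in>expo_box I D. c t \<noteq> 0"
    "\<forall>k\<in>expo_box J R. (\<Sum>t\<in>expo_box I D. c t * Poly_Mapping.lookup (P t) k) = 0"
    using underdetermined_system[OF expo_box_finite[OF J] expo_box_finite[OF I] card,
        of "\<lambda>k t. Poly_Mapping.lookup (P t) k"] by auto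
  define f where "f a = (\<Sum>t\<in>expo_box I D. c t * monom_eval t a)" for a
  have "f (\<lambda>i. g i s) = 0" for s
  proof -
    have "f (\<lambda>i. g i s) = (\<Sum>t\<in>expo_box I D. c t * cpoly_eval (P t) s)"
      by (simp add: f_def P(2))
    also have "\<dots> = (\<Sum>t\<in>expo_box I D. \<Sum>k\<in>expo_box J R.
        c t * Poly_Mapping.lookup (P t) k * monom_eval k s)"
      by (intro sum.cong refl)
        (simp add: cpoly_eval_superset[OF expo_box_finite[OF J] P(1)] sum_distrib_left mult.assoc)
    also have "\<dots> = (\<Sum>k\<in>expo_box J R. (\<Sum>t\<in>expo_box I D.
        c t * Poly_Mapping.lookup (P t) k) * monom_eval k s)"
      unfolding sum_distrib_right by (rule sum.swap)
    also have "\<dots> = 0" using c(2) by simp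
    finally show ?thesis .
  qed
  moreover have "poly_fun I f"
    unfolding f_def monom_eval_def by (intro poly_fun_intros) (auto simp: expo_box_def)
  moreover have "I \<noteq> {}" using lt by auto
  then have "\<exists>a\<in>coord_space I - {\<lambda>_. 0}. f a \<noteq> 0"
    using c(1) box_monomials_independent[OF I] unfolding f_def by blast
  ultimately show ?thesis by blast
qed

section \<open>The Zariski topology of projective space\<close>

definition hom_part :: "nat \<Rightarrow> 'i cpoly \<Rightarrow> 'i cpoly" where
  "hom_part d p = (\<Sum>t\<in>{t \<in> Poly_Mapping.keys p. monom_degree t = d}.
     Poly_Mapping.single t (Poly_Mapping.lookup p t))"

lemma keys_hom_part:
  "Poly_Mapping.keys (hom_part d p) \<subseteq> {t \<in> Poly_Mapping.keys p. monom_degree t = d}"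
proof -
  have "Poly_Mapping.keys (hom_part d p) \<subseteq> (\<Union>t\<in>{t \<in> Poly_Mapping.keys p. monom_degree t = d}.
      Poly_Mapping.keys (Poly_Mapping.single t (Poly_Mapping.lookup p t)))"
    unfolding hom_part_def by (rule keys_sum)
  then show ?thesis by (auto split: if_splits)
qed

text \<open>Along the ray through \<open>a\<close>, the value of \<open>p\<close> is a univariate
  polynomial in \<open>c\<close> whose coefficient at \<open>d\<close> is the component of degree
  \<open>d\<close> at \<open>a\<close>. It is zero as soon as it vanishes for all
  \<open>c \<noteq> 0\<close>.\<close>

lemma hom_part_zero_iff:
  "(\<forall>d. cpoly_eval (hom_part d p) a = 0) \<longleftrightarrow> (\<forall>c. c \<noteq> 0 \<longrightarrow> cpoly_eval p (\<lambda>i. c * a i) = 0)"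
proof -
  define q where "q = (\<Sum>t\<in>Poly_Mapping.keys p.
      Polynomial.monom (Poly_Mapping.lookup p t * monom_eval t a) (monom_degree t))"
  have coeff: "coeff q d = cpoly_eval (hom_part d p) a" for d
  proof -
    have "coeff q d = (\<Sum>t\<in>Poly_Mapping.keys p.
        if monom_degree t = d then Poly_Mapping.lookup p t * monom_eval t a else 0)"
      unfolding q_def coeff_sum by (intro sum.cong) auto
    also have "\<dots> = cpoly_eval (hom_part d p) a"
      unfolding hom_part_def cpoly_eval_sum by (simp add: sum.inter_filter)
    finally show ?thesis .
  qed
  have eval: "cpoly_eval p (\<lambda>i. c * a i) = poly q c" for c
    by (simp add: q_def cpoly_eval_def monom_eval_scale poly_sum poly_monom mult_ac)
  have "(\<forall>d. coeff q d = 0) \<longleftrightarrow> q = 0" by (simp add: poly_eq_iff)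
  also have "\<dots> \<longleftrightarrow> (\<forall>c. c \<noteq> 0 \<longrightarrow> poly q c = 0)"
    using complex_poly_nonroot_avoiding[of q "{0}"] by auto
  finally show ?thesis by (simp add: coeff eval)
qed

lemma coord_space_scale:
  "c \<noteq> 0 \<Longrightarrow> (\<lambda>i. c * a i) \<in> coord_space I - {\<lambda>_. 0} \<longleftrightarrow> a \<in> coord_space I - {\<lambda>_. 0}"
  by (auto simp: coord_space_def fun_eq_iff)

lemma mem_proj_class:
  assumes "a \<in> coord_space I - {\<lambda>_. 0}"
  shows "b \<in> proj_class I a \<longleftrightarrow> (\<exists>c. c \<noteq> 0 \<and> b = (\<lambda>i. c * a i))"
proof -
  have "(\<lambda>i. c * a i) \<in> coord_space I - {\<lambda>_. 0}" if "c \<noteq> 0" for c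
    using assms unfolding coord_space_scale[OF that] .
  moreover have "b \<in> proj_class I a \<longleftrightarrow>
      b \<in> coord_space I - {\<lambda>_. 0} \<and> (\<exists>c. c \<noteq> 0 \<and> b = (\<lambda>i. c * a i))"
    using assms by (simp add: proj_class_def proj_rel_def)
  ultimately show ?thesis by metis
qed

lemma proj_class_self: "a \<in> coord_space I - {\<lambda>_. 0} \<Longrightarrow> a \<in> proj_class I a"
  unfolding mem_proj_class by (rule exI[of _ 1]) simp

lemma proj_class_in_space: "a \<in> coord_space I - {\<lambda>_. 0} \<Longrightarrow> proj_class I a \<in> proj_space I"
  unfolding proj_class_def proj_space_def by (rule quotientI)

lemma proj_class_scale:
  assumes "a \<in> coord_space I - {\<lambda>_. 0}" "c \<noteq> 0"
  shows "proj_class I (\<lambda>i. c * a i) = proj_class I a"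
proof -
  have "(a, \<lambda>i. c * a i) \<in> proj_rel I"
    using mem_proj_class[OF assms(1), of "\<lambda>i. c * a i"] assms(2) by (auto simp: proj_class_def)
  then show ?thesis
    unfolding proj_class_def using equiv_class_eq[OF equiv_proj_rel] by blast
qed

lemma proj_spaceE:
  assumes "P \<in> proj_space I"
  obtains a where "a \<in> coord_space I - {\<lambda>_. 0}" "P = proj_class I a"
  using assms unfolding proj_space_def proj_class_def by (elim quotientE) auto

lemma mem_proj_spaceD:
  assumes "P \<in> proj_space I" "a \<in> P"
  shows "a \<in> coord_space I - {\<lambda>_. 0}" "P = proj_class I a"
proof -
  obtain b where b: "b \<in> coord_space I - {\<lambda>_. 0}" "P = proj_class I b"
    using assms(1) by (rule proj_spaceE)
  then obtain c where "c \<noteq> 0" "a = (\<lambda>i. c * b i)"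
    using assms(2) mem_proj_class by blast
  then show "a \<in> coord_space I - {\<lambda>_. 0}" "P = proj_class I a"
    using b proj_class_scale[OF b(1)] coord_space_scale[of c b I] by simp_all
qed

text \<open>Closed sets are cut out by homogeneous polynomials, whereas translates such as
  \<open>\<lambda>a. f (\<lambda>i. a i + t * p i)\<close> are in general inhomogeneous. A class
  contains all nonzero multiples of its members, so a polynomial vanishes on it exactly when all its
  homogeneous components do.\<close>

lemma closedin_zariski_poly_fun:
  assumes "\<And>f. f \<in> S \<Longrightarrow> poly_fun I f"
  shows "closedin (zariski_topology I) {P \<in> proj_space I. \<forall>f\<in>S. \<forall>a\<in>P. f a = 0}"
proof -
  define Q where "Q = {p. cpoly_vars p \<subseteq> I \<and> cpoly_eval p \<in> S}"
  define H where "H = (\<Union>p\<in>Q. range (\<lambda>d. hom_part d p))"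
  have S: "S = cpoly_eval ` Q" using assms by (auto simp: Q_def poly_fun_def)
  have key: "(\<forall>a\<in>P. cpoly_eval p a = 0) \<longleftrightarrow> (\<forall>d. \<forall>a\<in>P. cpoly_eval (hom_part d p) a = 0)"
    if P: "P \<in> proj_space I" for P p
  proof -
    have scale: "(\<lambda>i. c * a i) \<in> P" if "a \<in> P" "c \<noteq> 0" for a c
    proof -
      note a = mem_proj_spaceD[OF P that(1)]
      have "(\<lambda>i. c * a i) \<in> proj_class I a"
        unfolding mem_proj_class[OF a(1)] using that(2) by (intro exI[of _ c]) simp
      then show ?thesis unfolding a(2)[symmetric] .
    qed
    have "(\<forall>a\<in>P. cpoly_eval p a = 0)
        \<longleftrightarrow> (\<forall>a\<in>P. \<forall>c. c \<noteq> 0 \<longrightarrow> cpoly_eval p (\<lambda>i. c * a i) = 0)"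
    proof (intro iffI ballI allI impI)
      fix a and c :: complex assume "\<forall>a\<in>P. cpoly_eval p a = 0" "a \<in> P" "c \<noteq> 0"
      then show "cpoly_eval p (\<lambda>i. c * a i) = 0" using scale[of a c] by simp
    next
      fix a assume "\<forall>a\<in>P. \<forall>c. c \<noteq> 0 \<longrightarrow> cpoly_eval p (\<lambda>i. c * a i) = 0" "a \<in> P"
      then have "1 \<noteq> (0::complex) \<longrightarrow> cpoly_eval p (\<lambda>i. 1 * a i) = 0" by blast
      then show "cpoly_eval p a = 0" by simp
    qed
    then show ?thesis unfolding hom_part_zero_iff[symmetric] by blast
  qed
  have "homogeneous_cpoly h \<and> cpoly_vars h \<subseteq> I" if h: "h \<in> H" for h
  proof -
    obtain p d where p: "cpoly_vars p \<subseteq> I" "h = hom_part d p"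
      using h by (auto simp: H_def Q_def)
    have "\<forall>t\<in>Poly_Mapping.keys h. monom_degree t = d \<and> t \<in> Poly_Mapping.keys p"
      using keys_hom_part[of d p] p(2) by auto
    then show ?thesis using p(1) by (auto simp: homogeneous_cpoly_def cpoly_vars_def)
  qed
  moreover have "{P \<in> proj_space I. \<forall>f\<in>S. \<forall>a\<in>P. f a = 0} = proj_zero_locus I H"
  proof -
    have "(\<forall>f\<in>S. \<forall>a\<in>P. f a = 0) \<longleftrightarrow> (\<forall>h\<in>H. \<forall>a\<in>P. cpoly_eval h a = 0)"
      if P: "P \<in> proj_space I" for P
    proof -
      have "(\<forall>f\<in>S. \<forall>a\<in>P. f a = 0) \<longleftrightarrow> (\<forall>p\<in>Q. \<forall>a\<in>P. cpoly_eval p a = 0)"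
        by (simp add: S)
      also have "\<dots> \<longleftrightarrow> (\<forall>p\<in>Q. \<forall>d. \<forall>a\<in>P. cpoly_eval (hom_part d p) a = 0)"
        by (rule ball_cong[OF refl key[OF P]])
      also have "\<dots> \<longleftrightarrow> (\<forall>h\<in>H. \<forall>a\<in>P. cpoly_eval h a = 0)"
        by (simp add: H_def)
      finally show ?thesis .
    qed
    then show ?thesis unfolding proj_zero_locus_def by (intro Collect_cong conj_cong refl)
  qed
  ultimately show ?thesis
    unfolding closedin_zariski proj_algebraic_def by blast
qed

text \<open>The defining polynomials are homogeneous, so one representative decides membership of
  its class.\<close>

lemma closedin_zariskiE:
  assumes "closedin (zariski_topology I) A"
  obtains S where "\<And>f. f \<in> S \<Longrightarrow> poly_fun I f" "A \<subseteq> proj_space I"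
    "\<And>a. a \<in> coord_space I - {\<lambda>_. 0} \<Longrightarrow> proj_class I a \<in> A \<longleftrightarrow> (\<forall>f\<in>S. f a = 0)"
proof -
  obtain H where H: "\<And>p. p \<in> H \<Longrightarrow> homogeneous_cpoly p \<and> cpoly_vars p \<subseteq> I"
    "A = proj_zero_locus I H"
    using assms unfolding closedin_zariski proj_algebraic_def by blast
  show ?thesis
  proof (rule that[of "cpoly_eval ` H"])
    show "poly_fun I f" if "f \<in> cpoly_eval ` H" for f
      using that H(1) unfolding poly_fun_def by blast
    show "A \<subseteq> proj_space I" using H(2) by (auto simp: proj_zero_locus_def)
    show "proj_class I a \<in> A \<longleftrightarrow> (\<forall>f\<in>cpoly_eval ` H. f a = 0)"
      if a: "a \<in> coord_space I - {\<lambda>_. 0}" for a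
      using homogeneous_vanish_iff[OF _ proj_class_in_space[OF a] proj_class_self[OF a]]
        H proj_class_in_space[OF a] by (auto simp: proj_zero_locus_def)
  qed
qed

section \<open>Lines and irreducibility\<close>

lemma poly_fun_line_nonzero:
  assumes "poly_fun I f" "poly_fun I g"
    and "f (\<lambda>i. a i + s * d i) \<noteq> 0" "g (\<lambda>i. a i + t * d i) \<noteq> 0"
    and "\<And>u. u \<notin> X \<Longrightarrow> (\<lambda>i. a i + u * d i) \<noteq> (\<lambda>_. 0)" "finite X"
  shows "\<exists>u. f (\<lambda>i. a i + u * d i) \<noteq> 0 \<and> g (\<lambda>i. a i + u * d i) \<noteq> 0 \<and>
    (\<lambda>i. a i + u * d i) \<noteq> (\<lambda>_. 0)"
proof -
  obtain q r where q: "\<And>t. f (\<lambda>i. a i + t * d i) = poly q t"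
    and r: "\<And>t. g (\<lambda>i. a i + t * d i) = poly r t"
    using poly_fun_on_line assms(1,2) by metis
  \<comment> \<open>Each restriction is nonzero somewhere on the line, so the product is a nonzero
    polynomial and \<open>u\<close> can avoid its finitely many roots together with
    \<open>X\<close>.\<close>
  have "q * r \<noteq> 0" using assms(3,4) q r by auto
  then obtain u where "poly (q * r) u \<noteq> 0" "u \<notin> X"
    using complex_poly_nonroot_avoiding assms(6) by blast
  then show ?thesis using assms(5) q r by auto
qed

lemma poly_fun_common_nonzero:
  assumes "poly_fun I f" "poly_fun I g"
    and a: "a \<in> coord_space I - {\<lambda>_. 0}" "f a \<noteq> 0" and b: "b \<in> coord_space I - {\<lambda>_. 0}" "g b \<noteq> 0"
  shows "\<exists>c\<in>coord_space I - {\<lambda>_. 0}. f c \<noteq> 0 \<and> g c \<noteq> 0"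
proof -
  obtain k where k: "a k \<noteq> 0" using a(1) by auto
  \<comment> \<open>The line from \<open>a\<close> to \<open>b\<close> can meet the origin only
    where its coordinate \<open>k\<close> vanishes, and this affine function of \<open>u\<close> is
    nonzero because \<open>a k \<noteq> 0\<close>.\<close>
  define X where "X = {u. poly [:a k, b k - a k:] u = 0}"
  have fin: "finite X" unfolding X_def using k by (intro poly_roots_finite) auto
  have X: "(\<lambda>i. a i + u * (b i - a i)) \<noteq> (\<lambda>_. 0)" if "u \<notin> X" for u
    using that by (auto simp: X_def fun_eq_iff)
  obtain u where u: "f (\<lambda>i. a i + u * (b i - a i)) \<noteq> 0" "g (\<lambda>i. a i + u * (b i - a i)) \<noteq> 0"
    "(\<lambda>i. a i + u * (b i - a i)) \<noteq> (\<lambda>_. 0)"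
    using poly_fun_line_nonzero[OF assms(1,2), of a 0 "\<lambda>i. b i - a i" 1 X] X fin a(2) b(2) by auto
  moreover have "(\<lambda>i. a i + u * (b i - a i)) \<in> coord_space I"
    using a(1) b(1) by (auto simp: coord_space_def)
  ultimately show ?thesis by blast
qed

text \<open>A closed set containing \<open>S\<close> contains its closure, so covers by two closed
  sets need only be tested on \<open>S\<close>.\<close>

lemma irreducible_closedin_closure_of:
  assumes "S \<subseteq> topspace T" "S \<noteq> {}"
    and "\<And>A B. closedin T A \<Longrightarrow> closedin T B \<Longrightarrow> S \<subseteq> A \<union> B \<Longrightarrow> S \<subseteq> A \<or> S \<subseteq> B"
  shows "irreducible_closedin T (T closure_of S)"
  unfolding irreducible_closedin_def
proof (intro conjI allI impI)
  show "T closure_of S \<noteq> {}"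
    using assms(1,2) closure_of_subset by blast
  fix A B assume AB: "closedin T A \<and> closedin T B \<and> T closure_of S = A \<union> B"
  then have "S \<subseteq> A \<or> S \<subseteq> B"
    using assms(1,3) closure_of_subset by metis
  then have "T closure_of S \<subseteq> A \<or> T closure_of S \<subseteq> B"
    using AB closure_of_minimal by metis
  then show "T closure_of S = A \<or> T closure_of S = B" using AB by blast
qed simp

text \<open>Nonzero polynomial functions have a common point of nonvanishing, so two proper closed
  subsets cannot cover the space.\<close>

lemma irreducible_proj_space:
  assumes "proj_space I \<noteq> {}"
  shows "irreducible_closedin (zariski_topology I) (proj_space I)"
proof -
  have "proj_space I \<subseteq> A \<or> proj_space I \<subseteq> B"
    if A: "closedin (zariski_topology I) A" and B: "closedin (zariski_topology I) B"
      and AB: "proj_space I \<subseteq> A \<union> B" for A B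
  proof (rule ccontr)
    assume "\<not> ?thesis"
    then obtain P Q where PQ: "P \<in> proj_space I" "P \<notin> A" "Q \<in> proj_space I" "Q \<notin> B" by blast
    obtain a b where ab: "a \<in> coord_space I - {\<lambda>_. 0}" "P = proj_class I a"
      "b \<in> coord_space I - {\<lambda>_. 0}" "Q = proj_class I b"
      using PQ(1,3) by (auto elim!: proj_spaceE)
    obtain S where S: "\<And>f. f \<in> S \<Longrightarrow> poly_fun I f"
      "\<And>a. a \<in> coord_space I - {\<lambda>_. 0} \<Longrightarrow> proj_class I a \<in> A \<longleftrightarrow> (\<forall>f\<in>S. f a = 0)"
      using A by (rule closedin_zariskiE) blast
    obtain R where R: "\<And>f. f \<in> R \<Longrightarrow> poly_fun I f"
      "\<And>a. a \<in> coord_space I - {\<lambda>_. 0} \<Longrightarrow> proj_class I a \<in> B \<longleftrightarrow> (\<forall>f\<in>R. f a = 0)"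
      using B by (rule closedin_zariskiE) blast
    obtain f g where fg: "f \<in> S" "f a \<noteq> 0" "g \<in> R" "g b \<noteq> 0"
      using PQ ab S(2) R(2) by blast
    obtain c where "c \<in> coord_space I - {\<lambda>_. 0}" "f c \<noteq> 0" "g c \<noteq> 0"
      using poly_fun_common_nonzero[OF S(1)[OF fg(1)] R(1)[OF fg(3)] ab(1) fg(2) ab(3) fg(4)] by blast
    with AB S(2) R(2) fg(1,3) show False
      using proj_class_in_space by blast
  qed
  then have "irreducible_closedin (zariski_topology I) (zariski_topology I closure_of proj_space I)"
    using assms by (intro irreducible_closedin_closure_of) simp_all
  then show ?thesis
    using closure_of_topspace[of "zariski_topology I"] by simp
qed

section \<open>Cones and codimension\<close>

lemma codim_irreducible_ge_2:
  fixes I :: "'i set"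
  assumes Z: "irreducible_closedin (zariski_topology I) Z"
    and p: "p \<in> coord_space I - {\<lambda>_. 0}" "proj_class I p \<notin> Z"
    and f: "poly_fun I f" "\<exists>a\<in>coord_space I - {\<lambda>_. 0}. f a \<noteq> 0"
      "\<And>a t. a \<in> coord_space I - {\<lambda>_. 0} \<Longrightarrow> proj_class I a \<in> Z \<Longrightarrow> f (\<lambda>i. a i + t * p i) = 0"
  shows "codim_irreducible (zariski_topology I) Z \<ge> 2"
proof -
  let ?T = "zariski_topology I" and ?V = "coord_space I - {\<lambda>_. 0}"
  have clZ: "closedin ?T Z" and neZ: "Z \<noteq> {}"
    and irrZ: "\<And>A B. closedin ?T A \<Longrightarrow> closedin ?T B \<Longrightarrow> Z = A \<union> B \<Longrightarrow> Z = A \<or> Z = B"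
    using Z by (auto simp: irreducible_closedin_def)
  have ZI: "Z \<subseteq> proj_space I" using clZ closedin_subset by fastforce
  obtain P0 where P0: "P0 \<in> Z" using neZ by blast
  then obtain a0 where a0: "a0 \<in> ?V" "proj_class I a0 \<in> Z"
    using ZI proj_spaceE by (metis subsetD)
  \<comment> \<open>The cone over \<open>Z\<close> without its vertex: no \<open>a + t p\<close>
    with the class of \<open>a\<close> in \<open>Z\<close> is a multiple of \<open>p\<close>, since
    that would put the class of \<open>p\<close> in \<open>Z\<close>.\<close>
  define W where "W = {proj_class I (\<lambda>i. a i + t * p i) | a t. a \<in> ?V \<and> proj_class I a \<in> Z}"
  have line: "(\<lambda>i. a i + t * p i) \<in> ?V" if a: "a \<in> ?V" "proj_class I a \<in> Z" for a t
  proof -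
    have "(\<lambda>i. a i + t * p i) \<noteq> (\<lambda>_. 0)"
    proof
      assume "(\<lambda>i. a i + t * p i) = (\<lambda>_. 0)"
      then have eq: "a i = (- t) * p i" for i
        by (simp add: fun_eq_iff eq_neg_iff_add_eq_0)
      then have "t \<noteq> 0" using a(1) by auto
      moreover have "a = (\<lambda>i. (- t) * p i)" using eq by auto
      ultimately show False
        using proj_class_scale[OF p(1), of "- t"] a(2) p(2) by simp
    qed
    then show ?thesis using a(1) p(1) by (auto simp: coord_space_def)
  qed
  have WI: "W \<subseteq> proj_space I" using line proj_class_in_space by (auto simp: W_def)
  have ZW: "Z \<subseteq> W"
  proof
    fix P assume P: "P \<in> Z"
    then obtain a where "a \<in> ?V" "P = proj_class I a"
      using ZI proj_spaceE by (metis subsetD)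
    then show "P \<in> W" unfolding W_def using P by (auto intro!: exI[of _ a] exI[of _ 0])
  qed
  have shift: "poly_fun I (\<lambda>a. g (\<lambda>i. a i + t * p i))" if "poly_fun I g" for g t
    by (rule poly_fun_compose[OF that]) (intro poly_fun_intros)
  define D where "D = ?T closure_of W"
  have WD: "W \<subseteq> D" unfolding D_def using WI by (intro closure_of_subset) simp
  have "irreducible_closedin ?T D"
    unfolding D_def
  proof (rule irreducible_closedin_closure_of)
    fix A B assume A: "closedin ?T A" and B: "closedin ?T B" and AB: "W \<subseteq> A \<union> B"
    obtain S where S: "\<And>f. f \<in> S \<Longrightarrow> poly_fun I f"
      "\<And>a. a \<in> ?V \<Longrightarrow> proj_class I a \<in> A \<longleftrightarrow> (\<forall>f\<in>S. f a = 0)"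
      using A by (rule closedin_zariskiE) blast
    obtain R where R: "\<And>f. f \<in> R \<Longrightarrow> poly_fun I f"
      "\<And>a. a \<in> ?V \<Longrightarrow> proj_class I a \<in> B \<longleftrightarrow> (\<forall>f\<in>R. f a = 0)"
      using B by (rule closedin_zariskiE) blast
    \<comment> \<open>\<open>K S\<close> collects the points whose whole line in direction
      \<open>p\<close> lies in the zero set of \<open>S\<close>. For each \<open>t\<close> this is a
      polynomial condition, so \<open>K S\<close> is closed.\<close>
    define K where "K S = {P \<in> proj_space I. \<forall>f\<in>S. \<forall>t. \<forall>a\<in>P. f (\<lambda>i. a i + t * p i) = 0}"
      for S :: "(('i \<Rightarrow> complex) \<Rightarrow> complex) set"
    have K: "closedin ?T (K S)" if "\<And>f. f \<in> S \<Longrightarrow> poly_fun I f" for S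
    proof -
      let ?G = "\<Union>f\<in>S. range (\<lambda>t a. f (\<lambda>i. a i + t * p i))"
      have "closedin ?T {P \<in> proj_space I. \<forall>g\<in>?G. \<forall>a\<in>P. g a = 0}"
        using that shift by (intro closedin_zariski_poly_fun) auto
      then show ?thesis by (simp add: K_def)
    qed
    \<comment> \<open>Each line \<open>a + t p\<close> is irreducible, hence lies over
      \<open>A\<close> or over \<open>B\<close>. Irreducibility of \<open>Z\<close> then selects one
      of the two for all lines at once.\<close>
    have "Z \<subseteq> K S \<union> K R"
    proof (rule ccontr)
      assume "\<not> ?thesis"
      then obtain P where P: "P \<in> Z" "P \<notin> K S" "P \<notin> K R" by blast
      then have PI: "P \<in> proj_space I" using ZI by blast
      obtain f s x where fx: "f \<in> S" "x \<in> P" "f (\<lambda>i. x i + s * p i) \<noteq> 0"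
        using P(2) PI unfolding K_def by blast
      obtain g t y where gy: "g \<in> R" "y \<in> P" "g (\<lambda>i. y i + t * p i) \<noteq> 0"
        using P(3) PI unfolding K_def by blast
      have x: "x \<in> ?V" "P = proj_class I x" using mem_proj_spaceD[OF PI fx(2)] .
      have y: "y \<in> ?V" "P = proj_class I y" using mem_proj_spaceD[OF PI gy(2)] .
      \<comment> \<open>The two witnesses use different representatives of \<open>P\<close>. Passing
        from \<open>y = c x\<close> to \<open>x\<close> turns the parameter \<open>t\<close> into
        \<open>t / c\<close>, which puts both on one line.\<close>
      obtain c where c: "c \<noteq> 0" "y = (\<lambda>i. c * x i)"
        using gy(2) x mem_proj_class by blast
      have "(\<lambda>i. y i + t * p i) = (\<lambda>i. c * (x i + t / c * p i))"
        using c by (simp add: distrib_left)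
      then have "proj_class I (\<lambda>i. x i + t / c * p i) = proj_class I (\<lambda>i. y i + t * p i)"
        using proj_class_scale[OF line[of x "t / c"] c(1)] x P(1) by simp
      moreover have "proj_class I (\<lambda>i. y i + t * p i) \<notin> B"
        using R(2)[OF line[of y t]] y P(1) gy by blast
      ultimately obtain h where h: "h \<in> R" "h (\<lambda>i. x i + t / c * p i) \<noteq> 0"
        using R(2)[OF line[of x "t / c"]] x P(1) by auto
      obtain u where u: "f (\<lambda>i. x i + u * p i) \<noteq> 0" "h (\<lambda>i. x i + u * p i) \<noteq> 0"
        using poly_fun_line_nonzero[OF S(1)[OF fx(1)] R(1)[OF h(1)] fx(3) h(2), of "{}"]
          line[of x] x P(1) by auto
      have V: "(\<lambda>i. x i + u * p i) \<in> ?V" using line[of x u] x P(1) by simp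
      have "proj_class I (\<lambda>i. x i + u * p i) \<notin> A \<union> B"
        using S(2)[OF V] R(2)[OF V] fx(1) h(1) u by auto
      moreover have "proj_class I (\<lambda>i. x i + u * p i) \<in> W"
        using x P(1) unfolding W_def by (intro CollectI exI[of _ x] exI[of _ u]) simp
      ultimately show False using AB by auto
    qed
    then have "Z = (Z \<inter> K S) \<union> (Z \<inter> K R)" by blast
    then have or: "Z \<subseteq> K S \<or> Z \<subseteq> K R"
      using irrZ[OF closedin_Int[OF clZ K[OF S(1)]] closedin_Int[OF clZ K[OF R(1)]]] by blast
    have sub: "W \<subseteq> A" if "Z \<subseteq> K S"
      and "\<And>a. a \<in> ?V \<Longrightarrow> proj_class I a \<in> A \<longleftrightarrow> (\<forall>f\<in>S. f a = 0)" for A S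
    proof
      fix P assume "P \<in> W"
      then obtain a t where a: "P = proj_class I (\<lambda>i. a i + t * p i)" "a \<in> ?V" "proj_class I a \<in> Z"
        unfolding W_def by blast
      then have "proj_class I a \<in> K S" using that(1) by blast
      then have "f (\<lambda>i. a i + t * p i) = 0" if "f \<in> S" for f
        using that proj_class_self[OF a(2)] by (simp add: K_def)
      then show "P \<in> A" using that(2)[OF line[OF a(2,3)]] a(1) by simp
    qed
    show "W \<subseteq> A \<or> W \<subseteq> B"
      using or sub[OF _ S(2)] sub[OF _ R(2)] by blast
  qed (use WI ZW neZ in auto)
  moreover have "irreducible_closedin ?T (proj_space I)"
    using ZI neZ by (intro irreducible_proj_space) auto
  moreover have "D \<subset> proj_space I"
  proof -
    have "D \<subseteq> {P \<in> proj_space I. \<forall>g\<in>{f}. \<forall>a\<in>P. g a = 0}"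
      unfolding D_def
    proof (rule closure_of_minimal)
      show "closedin ?T {P \<in> proj_space I. \<forall>g\<in>{f}. \<forall>a\<in>P. g a = 0}"
        using f(1) by (intro closedin_zariski_poly_fun) auto
      \<comment> \<open>\<open>f\<close> need not be homogeneous, so every representative is
        checked: \<open>c (a + t p)\<close> again has the form in the hypothesis, with
        \<open>c a\<close> and \<open>c t\<close>.\<close>
      have "f b = 0" if a: "a \<in> ?V" "proj_class I a \<in> Z"
        and b: "b \<in> proj_class I (\<lambda>i. a i + t * p i)" for a b t
      proof -
        obtain c where c: "c \<noteq> 0" "b = (\<lambda>i. c * (a i + t * p i))"
          using b mem_proj_class[OF line[OF a, of t]] by blast
        then have "b = (\<lambda>i. c * a i + (c * t) * p i)" by (simp add: algebra_simps)
        moreover have "(\<lambda>i. c * a i) \<in> ?V" using a(1) unfolding coord_space_scale[OF c(1)] .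
        moreover have "proj_class I (\<lambda>i. c * a i) \<in> Z"
          using proj_class_scale[OF a(1) c(1)] a(2) by simp
        ultimately show ?thesis using f(3)[of "\<lambda>i. c * a i" "c * t"] by simp
      qed
      then have "W \<subseteq> {P. \<forall>b\<in>P. f b = 0}" unfolding W_def by auto
      then show "W \<subseteq> {P \<in> proj_space I. \<forall>g\<in>{f}. \<forall>a\<in>P. g a = 0}"
        using WI by blast
    qed
    moreover obtain a where a: "a \<in> ?V" "f a \<noteq> 0" using f(2) by blast
    ultimately show ?thesis using proj_class_in_space[OF a(1)] proj_class_self[OF a(1)] by blast
  qed
  moreover have "Z \<subset> D"
  proof (rule psubsetI)
    show "Z \<subseteq> D" using ZW WD by blast
    show "Z \<noteq> D"
    proof
      assume "Z = D"
      then have in_Z: "proj_class I (\<lambda>i. a0 i + t * p i) \<in> Z" for t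
      proof -
        have "proj_class I (\<lambda>i. a0 i + t * p i) \<in> W"
          using a0 unfolding W_def by (intro CollectI exI[of _ a0] exI[of _ t]) simp
        then show ?thesis using WD \<open>Z = D\<close> by auto
      qed
      obtain S where S: "\<And>f. f \<in> S \<Longrightarrow> poly_fun I f"
        "\<And>a. a \<in> ?V \<Longrightarrow> proj_class I a \<in> Z \<longleftrightarrow> (\<forall>f\<in>S. f a = 0)"
        using clZ by (rule closedin_zariskiE) blast
      \<comment> \<open>The vertex is reached at \<open>s = 0\<close>: for
        \<open>s \<noteq> 0\<close> the vector \<open>p + s a0\<close> is a multiple of
        \<open>a0 + inverse s p\<close> and so lies over \<open>Z\<close>, and a polynomial in
        \<open>s\<close> vanishing off \<open>0\<close> vanishes at \<open>0\<close>. This puts the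
        class of \<open>p\<close> in \<open>Z\<close>.\<close>
      have "g p = 0" if g: "g \<in> S" for g
      proof -
        obtain q where q: "\<And>t. g (\<lambda>i. p i + t * a0 i) = poly q t"
          using poly_fun_on_line[OF S(1)[OF g]] by metis
        have "poly q s = 0" if s: "s \<noteq> 0" for s
        proof -
          have eq: "(\<lambda>i. s * (a0 i + inverse s * p i)) = (\<lambda>i. p i + s * a0 i)"
            using s by (simp add: distrib_left mult.assoc[symmetric] add.commute)
          have "proj_class I (\<lambda>i. p i + s * a0 i) \<in> Z"
            using proj_class_scale[OF line[OF a0] s, of "inverse s"] in_Z[of "inverse s"]
            unfolding eq by simp
          moreover have V: "(\<lambda>i. p i + s * a0 i) \<in> ?V"
            unfolding eq[symmetric] coord_space_scale[OF s] by (rule line[OF a0])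
          ultimately show ?thesis using S(2)[OF V] g q by auto
        qed
        then have "q = 0" using complex_poly_nonroot_avoiding[of q "{0}"] by auto
        then show ?thesis using q[of 0] by simp
      qed
      then show False using S(2)[OF p(1)] p(2) by simp
    qed
  qed
  ultimately have "\<exists>C :: nat \<Rightarrow> _. C 0 = Z \<and> (\<forall>i\<le>2. irreducible_closedin ?T (C i)) \<and>
      (\<forall>i<2. C i \<subset> C (Suc i))"
    using Z by (intro exI[of _ "\<lambda>i. if i = 0 then Z else if i = 1 then D else proj_space I"])
      (auto simp: less_2_cases_iff)
  then have "enat 2 \<in> {enat k | k. \<exists>C :: nat \<Rightarrow> _. C 0 = Z \<and>
      (\<forall>i\<le>k. irreducible_closedin ?T (C i)) \<and> (\<forall>i<k. C i \<subset> C (Suc i))}" by blast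
  then have "enat 2 \<le> codim_irreducible ?T Z"
    unfolding codim_irreducible_def by (rule Sup_upper)
  then show ?thesis by (simp add: numeral_eq_enat)
qed

text \<open>\<open>cone\<close> is applied twice. With vertex zero it gives a nonzero polynomial
  function vanishing over \<open>Y\<close>, hence a point \<open>p\<close> outside the closure; with
  vertex \<open>p\<close> it gives the function that keeps the cone from filling the space.\<close>

lemma codimension_closure_of_ge_2:
  assumes Y: "Y \<subseteq> proj_space I"
    and cone: "\<And>p. p \<in> coord_space I \<Longrightarrow> \<exists>f. poly_fun I f \<and> (\<exists>a\<in>coord_space I - {\<lambda>_. 0}. f a \<noteq> 0) \<and>
      (\<forall>a t. a \<in> coord_space I - {\<lambda>_. 0} \<and> proj_class I a \<in> Y \<longrightarrow> f (\<lambda>i. a i + t * p i) = 0)"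
  shows "codimension (zariski_topology I) (zariski_topology I closure_of Y) \<ge> 2"
  unfolding codimension_def
proof (rule INF_greatest)
  let ?T = "zariski_topology I" and ?V = "coord_space I - {\<lambda>_. 0}"
  fix Z assume "Z \<in> {Z. irreducible_closedin ?T Z \<and> Z \<subseteq> ?T closure_of Y}"
  then have Z: "irreducible_closedin ?T Z" "Z \<subseteq> ?T closure_of Y" by auto
  \<comment> \<open>For fixed \<open>t\<close> and \<open>p\<close> the condition is closed, so it
    extends from \<open>Y\<close> to its closure.\<close>
  have vanish: "f (\<lambda>i. a i + t * p i) = 0"
    if f: "poly_fun I f" and fY: "\<forall>a t. a \<in> ?V \<and> proj_class I a \<in> Y \<longrightarrow> f (\<lambda>i. a i + t * p i) = 0"
      and a: "a \<in> ?V" "proj_class I a \<in> Z" for f a t p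
  proof -
    let ?K = "{P \<in> proj_space I. \<forall>g\<in>{\<lambda>a. f (\<lambda>i. a i + t * p i)}. \<forall>a\<in>P. g a = 0}"
    have sub: "?T closure_of Y \<subseteq> ?K"
    proof (rule closure_of_minimal)
      have "poly_fun I (\<lambda>a. f (\<lambda>i. a i + t * p i))"
        by (rule poly_fun_compose[OF f]) (intro poly_fun_intros)
      then show "closedin ?T ?K" by (intro closedin_zariski_poly_fun) auto
      show "Y \<subseteq> ?K"
      proof
        fix P assume P: "P \<in> Y"
        then have PI: "P \<in> proj_space I" using Y by blast
        have "f (\<lambda>i. b i + t * p i) = 0" if "b \<in> P" for b
          using fY mem_proj_spaceD[OF PI that] P by simp
        then show "P \<in> ?K" using PI by simp
      qed
    qed
    have "proj_class I a \<in> ?K" by (rule subsetD[OF subset_trans[OF Z(2) sub] a(2)])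
    then show ?thesis using proj_class_self[OF a(1)] by simp
  qed
  have "(\<lambda>_. 0) \<in> coord_space I" by (simp add: coord_space_def)
  from cone[OF this] obtain f where f: "poly_fun I f" "\<exists>a\<in>?V. f a \<noteq> 0"
    "\<forall>a t. a \<in> ?V \<and> proj_class I a \<in> Y \<longrightarrow> f (\<lambda>i. a i + t * 0) = 0"
    by blast
  obtain p where p: "p \<in> ?V" "f p \<noteq> 0" using f(2) by blast
  have "proj_class I p \<notin> Z" using vanish[OF f(1,3) p(1)] p(2) by auto
  moreover obtain g where "poly_fun I g" "\<exists>a\<in>?V. g a \<noteq> 0"
    "\<forall>a t. a \<in> ?V \<and> proj_class I a \<in> Y \<longrightarrow> g (\<lambda>i. a i + t * p i) = 0"
    using cone[of p] p(1) by blast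
  ultimately show "2 \<le> codim_irreducible ?T Z"
    using codim_irreducible_ge_2[OF Z(1) p(1)] vanish by blast
qed

section \<open>Irregular hypermatrices\<close>

lemma hm_indices_Suc:
  "hm_indices n (Suc r) = (\<lambda>(i, js). i # js) ` ({1..n} \<times> hm_indices n r)"
proof (rule set_eqI)
  fix ks
  show "ks \<in> hm_indices n (Suc r) \<longleftrightarrow> ks \<in> (\<lambda>(i, js). i # js) ` ({1..n} \<times> hm_indices n r)"
    by (cases ks) (auto simp: hm_indices_def image_iff)
qed

lemma finite_hm_indices: "finite (hm_indices n r)"
  using finite_lists_length_eq[of "{1..n}" r] by (simp add: hm_indices_def conj_commute)

text \<open>Expanding the power of a sum gives one term for each word of length \<open>r\<close>.
  Applied to the products \<open>w i * x i\<close>, this evaluates the pairing of the tensor powers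
  of \<open>w\<close> and \<open>x\<close>.\<close>

lemma sum_hm_indices_prod_list:
  fixes x :: "nat \<Rightarrow> complex"
  shows "(\<Sum>js\<in>hm_indices n r. prod_list (map x js)) = (\<Sum>i=1..n. x i) ^ r"
proof (induction r)
  case 0
  have "hm_indices n 0 = {[]}" by (auto simp: hm_indices_def)
  then show ?case by simp
next
  case (Suc r)
  have "inj_on (\<lambda>(i, js). i # js) ({1..n} \<times> hm_indices n r)" by (auto simp: inj_on_def)
  then have "(\<Sum>js\<in>hm_indices n (Suc r). prod_list (map x js))
      = (\<Sum>(i, js)\<in>{1..n} \<times> hm_indices n r. x i * prod_list (map x js))"
    by (simp add: hm_indices_Suc sum.reindex case_prod_unfold)
  also have "\<dots> = (\<Sum>i=1..n. x i) * (\<Sum>js\<in>hm_indices n r. prod_list (map x js))"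
    by (simp add: sum_product sum.cartesian_product)
  finally show ?case by (simp add: Suc.IH)
qed

lemma prod_list_map_mult:
  fixes x y :: "'a \<Rightarrow> complex"
  shows "prod_list (map (\<lambda>i. x i * y i) js) = prod_list (map x js) * prod_list (map y js)"
  by (induction js) auto

lemma prod_list_map_scale:
  fixes x :: "'a \<Rightarrow> complex"
  shows "prod_list (map (\<lambda>i. c * x i) js) = c ^ length js * prod_list (map x js)"
  by (induction js) auto

lemma hm_apply_scale_vec: "hm_apply n m A (\<lambda>i. c * x i) i = c ^ (m - 1) * hm_apply n m A x i"
  unfolding hm_apply_def sum_distrib_left
  by (intro sum.cong refl) (auto simp: prod_list_map_scale hm_indices_def)

lemma hm_apply_scale_hm: "hm_apply n m (\<lambda>is. c * A is) x i = c * hm_apply n m A x i"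
  unfolding hm_apply_def sum_distrib_left by (simp add: mult.assoc)

lemma irregular_scale: "irregular n m A \<Longrightarrow> irregular n m (\<lambda>is. c * A is)"
  by (auto simp: irregular_def hm_apply_scale_hm)

text \<open>On the chart \<open>x\<^sub>j + \<i> x\<^sub>k = 1\<close> isotropy reads \<open>x\<^sub>j - \<i> x\<^sub>k = - (\<Sum>l\<noteq>j,k. x\<^sub>l\<^sup>2)\<close>, so \<open>x\<close> is a polynomial in
  its other \<open>n - 2\<close> coordinates. With \<open>w = e\<^sub>j + \<i> e\<^sub>k\<close>, so that \<open>w\<^sup>T x = 1\<close>, and \<open>r = m - 1\<close>, each row
  orthogonal to \<open>x\<^sup>\<otimes>\<^sup>r\<close> is \<open>b - \<langle>b, x\<^sup>\<otimes>\<^sup>r\<rangle> w\<^sup>\<otimes>\<^sup>r\<close> for a unique \<open>b\<close> whose entry at \<open>(j, \<dots>, j)\<close> is \<open>0\<close>.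
  The \<open>n\<close> positions \<open>(i, j, \<dots>, j)\<close> freed in this way store the parameters \<open>x\<^sub>i\<close> for \<open>i \<noteq> j, k\<close>, and
  \<open>t\<close> at \<open>i = j\<close>; the position with \<open>i = k\<close> is not needed.\<close>

lemma irregular_chart_relation:
  assumes m: "m \<ge> 2" and jk: "j \<in> {1..n}" "k \<in> {1..n}" "j \<noteq> k"
  shows "\<exists>f. poly_fun (hm_indices n m) f \<and>
    (\<exists>a\<in>coord_space (hm_indices n m) - {\<lambda>_. 0}. f a \<noteq> 0) \<and>
    (\<forall>A t x. (\<forall>i\<in>{1..n}. hm_apply n m A x i = 0) \<and> (\<Sum>i=1..n. (x i)\<^sup>2) = 0 \<and> x j + \<i> * x k = 1 \<longrightarrow>
      f (\<lambda>is. A is + t * p is) = 0)"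
proof -
  define I where "I = hm_indices n m"
  define rep where "rep = replicate (m - 1) j"
  define J where "J = I - {k # rep}"
  define w where "w i = (if i = j then 1 else if i = k then \<i> else 0)" for i
  define L where "L = {1..n} - {j, k}"
  define v where "v s = - (\<Sum>l\<in>L. (s (l # rep))\<^sup>2)" for s :: "nat list \<Rightarrow> complex"
  \<comment> \<open>Adding and subtracting \<open>x j + \<i> * x k = 1\<close> and
    \<open>x j - \<i> * x k = v\<close> gives the first two formulas.\<close>
  define y where "y i s = (if i = j then (1 + v s) * (1/2) else if i = k then (1 - v s) * (1 / (2 * \<i>))
      else s (i # rep))" for i s
  define b where "b is s = (if tl is = rep then 0 else s is)" for "is" and s :: "nat list \<Rightarrow> complex"
  define g where "g is s = b is s - (\<Sum>js\<in>hm_indices n (m - 1). b (hd is # js) s *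
      prod_list (map (\<lambda>i. y i s) js)) * prod_list (map w (tl is)) + s (j # rep) * p is" for "is" s
  have m': "m = Suc (m - 1)" using m by simp
  have Cons_I: "i # js \<in> I \<longleftrightarrow> i \<in> {1..n} \<and> js \<in> hm_indices n (m - 1)" for i js
    unfolding I_def by (subst m') (auto simp: hm_indices_Suc)
  have I_cases: "\<exists>i js. is = i # js \<and> i \<in> {1..n} \<and> js \<in> hm_indices n (m - 1)" if "is \<in> I" for "is"
    using that unfolding I_def by (subst (asm) m') (auto simp: hm_indices_Suc)
  have rep: "rep \<in> hm_indices n (m - 1)"
    using jk by (auto simp: rep_def hm_indices_def)
  have J: "i # js \<in> J" if "i \<in> {1..n}" "js \<in> hm_indices n (m - 1)" "i \<noteq> k \<or> js \<noteq> rep" for i js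
    using that by (auto simp: J_def Cons_I)
  have Lk: "l \<noteq> k" "l \<in> {1..n}" if "l \<in> L" for l using that by (auto simp: L_def)
  have pv: "poly_fun J v"
  proof -
    have "poly_fun J (\<lambda>s. 0 - (\<Sum>l\<in>L. (s (l # rep))\<^sup>2))"
      using J rep Lk by (intro poly_fun_intros) auto
    then show ?thesis by (simp add: v_def[abs_def])
  qed
  have py: "poly_fun J (y i)" if "i \<in> {1..n}" for i
  proof -
    consider "i = j" | "i \<noteq> j" "i = k" | "i \<noteq> j" "i \<noteq> k" by blast
    then show ?thesis
    proof cases
      case 1
      have "poly_fun J (\<lambda>s. (1 + v s) * (1/2))" by (intro poly_fun_intros pv)
      with 1 show ?thesis by (simp add: y_def[abs_def])
    next
      case 2
      have "poly_fun J (\<lambda>s. (1 - v s) * (1 / (2 * \<i>)))" by (intro poly_fun_intros pv)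
      with 2 show ?thesis by (simp add: y_def[abs_def])
    next
      case 3
      have "poly_fun J (\<lambda>s. s (i # rep))" using 3 J rep that by (intro poly_fun_var) auto
      with 3 show ?thesis by (simp add: y_def[abs_def])
    qed
  qed
  have pb: "poly_fun J (b (i # js))" if "i \<in> {1..n}" "js \<in> hm_indices n (m - 1)" for i js
  proof (cases "js = rep")
    case True
    then show ?thesis using poly_fun_const[of J 0] by (simp add: b_def[abs_def])
  next
    case False
    have "poly_fun J (\<lambda>s. s (i # js))" using False J that by (intro poly_fun_var) auto
    with False show ?thesis by (simp add: b_def[abs_def])
  qed
  have pg: "poly_fun J (g is)" if is_I: "is \<in> I" for "is"
  proof -
    obtain i js where is_eq: "is = i # js" "i \<in> {1..n}" "js \<in> hm_indices n (m - 1)"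
      using I_cases[OF is_I] by blast
    have py': "poly_fun J (y l)" if "l \<in> set js'" "js' \<in> hm_indices n (m - 1)" for l js'
      using that by (intro py) (auto simp: hm_indices_def)
    have "j # rep \<in> J" using J rep jk by auto
    then show ?thesis
      unfolding g_def[abs_def] is_eq(1) list.sel
      by (intro poly_fun_add poly_fun_diff poly_fun_mult poly_fun_sum poly_fun_prod_list
        poly_fun_const poly_fun_var pb py' is_eq)
  qed
  have fin: "finite I" by (simp add: I_def finite_hm_indices)
  have "k # rep \<in> I" using jk rep by (simp add: Cons_I)
  then have "card J < card I" unfolding J_def using fin by (intro psubset_card_mono) auto
  moreover have "finite J" using fin by (simp add: J_def)
  ultimately obtain f where f: "poly_fun I f" "\<And>s. f (\<lambda>is. g is s) = 0"
    "\<exists>a\<in>coord_space I - {\<lambda>_. 0}. f a \<noteq> 0"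
    using algebraic_dependence[OF fin, of J g] pg by blast
  have "f (\<lambda>is. A is + t * p is) = 0"
    if A: "\<forall>i\<in>{1..n}. hm_apply n m A x i = 0" and iso: "(\<Sum>i=1..n. (x i)\<^sup>2) = 0"
      and chart: "x j + \<i> * x k = 1" for A t x
  proof -
    \<comment> \<open>The parameters that reproduce \<open>A + t p\<close>: positions ending in
      \<open>rep\<close> hold \<open>t\<close> and coordinates of \<open>x\<close>; the others hold
      the entries of \<open>A\<close> minus the multiple of the tensor power of \<open>w\<close>
      that makes each row vanish at \<open>rep\<close>.\<close>
    define s where "s is = (if tl is = rep then if hd is = j then t else x (hd is)
        else A is - A (hd is # rep) * prod_list (map w (tl is)))" for "is"
    have wrep: "prod_list (map w rep) = 1"
      by (simp add: rep_def w_def map_replicate prod_list_replicate)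
    have bs: "b (i # js) s = A (i # js) - A (i # rep) * prod_list (map w js)" for i js
      by (auto simp: b_def s_def wrep)
    have range: "{1..n} = insert j (insert k L)" using jk by (auto simp: L_def)
    have set: "(\<Sum>i=1..n. h i) = h j + (h k + (\<Sum>l\<in>L. h l))" for h :: "nat \<Rightarrow> complex"
      unfolding range using jk(3) by (simp add: L_def)
    \<comment> \<open>Isotropy trades the remaining squares for those at \<open>j\<close> and
      \<open>k\<close>, whose sum factors with first factor \<open>1\<close> on the chart.\<close>
    have "v s = - (\<Sum>l\<in>L. (x l)\<^sup>2)"
      unfolding v_def by (intro arg_cong[of _ _ uminus] sum.cong) (auto simp: s_def L_def)
    also have "\<dots> = (x j)\<^sup>2 + (x k)\<^sup>2"
      using iso unfolding set by (simp add: neg_eq_iff_add_eq_0 add_ac)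
    also have "\<dots> = (x j + \<i> * x k) * (x j - \<i> * x k)"
      by (simp add: algebra_simps power2_eq_square)
    finally have v: "v s = x j - \<i> * x k" by (simp add: chart)
    have yx: "y i s = x i" for i
    proof -
      have "x j = 1 - \<i> * x k" using chart by (simp add: eq_diff_eq)
      then have "(1 + v s) * (1 / 2) = x j" "(1 - v s) * (1 / (2 * \<i>)) = x k"
        unfolding v by (simp_all add: field_simps)
      then show ?thesis by (auto simp: y_def s_def)
    qed
    have "g (i # js) s = A (i # js) + t * p (i # js)" if "i \<in> {1..n}" for i js
    proof -
      have wx: "(\<Sum>js\<in>hm_indices n (m - 1). prod_list (map w js) * prod_list (map x js)) = 1"
      proof -
        have "(\<Sum>i=1..n. w i * x i) = 1"
          unfolding set using jk chart by (auto simp: w_def L_def intro: sum.neutral)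
        then show ?thesis by (simp add: prod_list_map_mult[symmetric] sum_hm_indices_prod_list)
      qed
      \<comment> \<open>Row \<open>i\<close> of \<open>A\<close> is orthogonal to the tensor power
        of \<open>x\<close>, so only the correction contributes; subtracting this pairing in
        \<open>g\<close> restores the row of \<open>A\<close>.\<close>
      have "(\<Sum>js\<in>hm_indices n (m - 1). b (i # js) s * prod_list (map x js))
        = hm_apply n m A x i - A (i # rep) *
          (\<Sum>js\<in>hm_indices n (m - 1). prod_list (map w js) * prod_list (map x js))"
        by (simp add: bs hm_apply_def left_diff_distrib sum_subtractf sum_distrib_left mult.assoc)
      also have "\<dots> = - A (i # rep)" unfolding wx using A that by simp
      finally show ?thesis
        by (simp add: g_def yx bs) (simp add: s_def)
    qed
    then have "g is s = A is + t * p is" if "is \<in> I" for "is"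
      using I_cases[OF that] by auto
    then have "f (\<lambda>is. A is + t * p is) = f (\<lambda>is. g is s)"
      by (intro poly_fun_cong[OF f(1)]) simp
    then show ?thesis by (simp add: f(2))
  qed
  then show ?thesis using f(1,3) unfolding I_def by blast
qed

section \<open>Combining the charts\<close>

lemma poly_fun_prod_nonzero:
  assumes "finite C" "C \<noteq> {}" "\<And>c. c \<in> C \<Longrightarrow> poly_fun I (f c)"
    and "\<And>c. c \<in> C \<Longrightarrow> \<exists>a\<in>coord_space I - {\<lambda>_. 0}. f c a \<noteq> 0"
  shows "\<exists>a\<in>coord_space I - {\<lambda>_. 0}. (\<Prod>c\<in>C. f c a) \<noteq> 0"
  using assms
proof (induction C rule: finite_ne_induct)
  case (insert c C)
  obtain a where a: "a \<in> coord_space I - {\<lambda>_. 0}" "f c a \<noteq> 0"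
    using insert.prems(2)[of c] by auto
  obtain b where b: "b \<in> coord_space I - {\<lambda>_. 0}" "(\<Prod>c\<in>C. f c b) \<noteq> 0"
    using insert.IH insert.prems by blast
  have "poly_fun I (\<lambda>a. \<Prod>c\<in>C. f c a)" using insert.prems(1) by (intro poly_fun_prod) auto
  from poly_fun_common_nonzero[OF insert.prems(1) this a b] show ?case
    using insert.hyps by simp
qed simp

text \<open>Both equations are homogeneous in \<open>x\<close>, so it suffices to find a nonzero
  value \<open>x j + \<i> * x k\<close> and rescale by its inverse.\<close>

lemma irregular_chart:
  assumes "n \<ge> 2" "irregular n m A"
  obtains j k x where "j \<in> {1..n}" "k \<in> {1..n}" "j \<noteq> k" "x j + \<i> * x k = 1"
    "\<forall>i\<in>{1..n}. hm_apply n m A x i = 0" "(\<Sum>i=1..n. (x i)\<^sup>2) = 0"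
proof -
  obtain x where x: "x \<in> coord_space {1..n}" "x \<noteq> (\<lambda>_. 0)"
    "\<forall>i\<in>{1..n}. hm_apply n m A x i = 0" "(\<Sum>i=1..n. (x i)\<^sup>2) = 0"
    using assms(2) by (auto simp: irregular_def)
  obtain l where l: "x l \<noteq> 0" using x(2) by auto
  then have l': "l \<in> {1..n}" using x(1) by (auto simp: coord_space_def)
  obtain q where q: "q \<in> {1..n}" "q \<noteq> l"
    using assms(1) by (cases "l = 1") (auto intro: that[of 1] that[of 2])
  \<comment> \<open>If both forms vanished, substituting one into the other would give
    \<open>x l = - x l\<close>, although \<open>x l \<noteq> 0\<close>.\<close>
  have "x l + \<i> * x q \<noteq> 0 \<or> x q + \<i> * x l \<noteq> 0"
  proof (rule ccontr)
    assume "\<not> ?thesis"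
    then have "x l = - \<i> * x q" "x q = - \<i> * x l" by (simp_all add: eq_neg_iff_add_eq_0)
    then have "x l = - x l" by (metis mult.assoc mult_minus_left i_squared minus_minus mult_1 mult_minus1)
    then show False using l by simp
  qed
  then obtain j k where jk: "j \<in> {1..n}" "k \<in> {1..n}" "j \<noteq> k" "x j + \<i> * x k \<noteq> 0"
    using l' q by metis
  define c where "c = inverse (x j + \<i> * x k)"
  show ?thesis
  proof (rule that[OF jk(1-3), of "\<lambda>i. c * x i"])
    have "c * x j + \<i> * (c * x k) = c * (x j + \<i> * x k)" by (simp add: algebra_simps)
    then show "c * x j + \<i> * (c * x k) = 1" using jk(4) by (simp add: c_def)
    show "\<forall>i\<in>{1..n}. hm_apply n m A (\<lambda>i. c * x i) i = 0"
      using x(3) by (simp add: hm_apply_scale_vec)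
    show "(\<Sum>i=1..n. (c * x i)\<^sup>2) = 0"
      using x(4) by (simp add: power_mult_distrib sum_distrib_left[symmetric])
  qed
qed

theorem theorem7:
  fixes n m :: nat
  assumes "n \<ge> 2" and "m \<ge> 2"
  shows "codimension (zariski_topology (hm_indices n m))
           (zariski_topology (hm_indices n m) closure_of irregular_classes n m) \<ge> 2"
proof (rule codimension_closure_of_ge_2)
  let ?I = "hm_indices n m"
  let ?V = "coord_space ?I - {\<lambda>_. 0}"
  show "irregular_classes n m \<subseteq> proj_space ?I"
    using proj_class_in_space by (auto simp: irregular_classes_def)
  fix p :: "nat list \<Rightarrow> complex"
  \<comment> \<open>Ordered pairs index finitely many charts covering all irregular hypermatrices,
    so the product of the chart relations vanishes on the whole cone.\<close>
  define C where "C = {(j, k). j \<in> {1..n} \<and> k \<in> {1..n} \<and> j \<noteq> k}"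
  have "\<forall>c\<in>C. \<exists>f. poly_fun ?I f \<and> (\<exists>a\<in>?V. f a \<noteq> 0) \<and>
    (\<forall>A t x. (\<forall>i\<in>{1..n}. hm_apply n m A x i = 0) \<and> (\<Sum>i=1..n. (x i)\<^sup>2) = 0 \<and>
      x (fst c) + \<i> * x (snd c) = 1 \<longrightarrow> f (\<lambda>is. A is + t * p is) = 0)"
    using irregular_chart_relation[OF assms(2)] by (auto simp: C_def)
  then obtain f where f: "\<And>c. c \<in> C \<Longrightarrow> poly_fun ?I (f c)"
    "\<And>c. c \<in> C \<Longrightarrow> \<exists>a\<in>?V. f c a \<noteq> 0"
    "\<And>c A t x. c \<in> C \<Longrightarrow> \<forall>i\<in>{1..n}. hm_apply n m A x i = 0 \<Longrightarrow> (\<Sum>i=1..n. (x i)\<^sup>2) = 0 \<Longrightarrow>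
      x (fst c) + \<i> * x (snd c) = 1 \<Longrightarrow> f c (\<lambda>is. A is + t * p is) = 0"
    by (subst (asm) bchoice_iff) blast
  have finC: "finite C" by (rule finite_subset[of _ "{1..n} \<times> {1..n}"]) (auto simp: C_def)
  have "(1, 2) \<in> C" using assms(1) by (simp add: C_def)
  then have "\<exists>a\<in>?V. (\<Prod>c\<in>C. f c a) \<noteq> 0"
    using f(1,2) finC by (intro poly_fun_prod_nonzero) auto
  moreover have "poly_fun ?I (\<lambda>a. \<Prod>c\<in>C. f c a)" using f(1) by (rule poly_fun_prod)
  moreover have "(\<Prod>c\<in>C. f c (\<lambda>is. a is + t * p is)) = 0"
    if a: "a \<in> ?V" "proj_class ?I a \<in> irregular_classes n m" for a t
  proof -
    \<comment> \<open>Membership of the class only provides an irregular \<open>A\<close>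
      proportional to \<open>a\<close>; irregularity is then transferred by scaling.\<close>
    obtain A where A: "proj_class ?I a = proj_class ?I A" "A \<in> ?V" "irregular n m A"
      using a(2) by (auto simp: irregular_classes_def)
    then obtain c where "a = (\<lambda>is. c * A is)"
      using proj_class_self[OF a(1)] mem_proj_class[OF A(2)] by auto
    then have "irregular n m a" using irregular_scale[OF A(3)] by simp
    then obtain j k x where x: "j \<in> {1..n}" "k \<in> {1..n}" "j \<noteq> k" "x j + \<i> * x k = 1"
      "\<forall>i\<in>{1..n}. hm_apply n m a x i = 0" "(\<Sum>i=1..n. (x i)\<^sup>2) = 0"
      by (rule irregular_chart[OF assms(1)])
    have jk: "(j, k) \<in> C" using x(1-3) by (simp add: C_def)
    show ?thesis
      using f(3)[OF jk x(5,6)] x(4) by (intro prod_zero[OF finC] bexI[OF _ jk]) simp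
  qed
  ultimately show "\<exists>f. poly_fun ?I f \<and> (\<exists>a\<in>?V. f a \<noteq> 0) \<and>
      (\<forall>a t. a \<in> ?V \<and> proj_class ?I a \<in> irregular_classes n m \<longrightarrow> f (\<lambda>is. a is + t * p is) = 0)"
    by (intro exI[of _ "\<lambda>a. \<Prod>c\<in>C. f c a"]) auto
qed

end
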